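(* Let $T$ be a bounded operator on a Hilbert space $H$ whose spectrum has no nonzero limit points. Let $B_T$ be the norm closed subalgebra of $B(H)$ generated by $T$, and let $B$ be the norm closed subalgebra generated by the minimal spectral idempotents of $T$. If $B_T$ is semisimple and weakly compact, and if $B$ has a bounded approximate identity, then $B=B_T$.
   Context: The (norm closed) algebra generated by a set is the smallest norm closed (not necessarily unital) subalgebra containing the set. The minimal spectral idempotents of $T$ are the spectral idempotents obtained from the analytic functional calculus of $T$ for the nonzero isolated points $\lambda$ of $\mathrm{Sp}(T)$ (apply a function equal to $1$ near $\lambda$ and $0$ near the rest of the spectrum). A commutative Banach algebra $A$ is called weakly compact if for every $a\in A$ the operator $b\mapsto ab$ on $A$ is weakly compact. *)

theory Defs
  imports "HOL-Complex_Analysis.Complex_Analysis"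
begin

section \<open>Complex Hilbert spaces\<close>

text \<open>
  The complex structure is added on top of the library's class of real Banach spaces, so that
  completeness and real bounded operators (\<open>blinfun\<close>) are available.
  The inner product is linear in its first argument.
\<close>

class complex_hilbert = banach +
  fixes scaleC :: "complex \<Rightarrow> 'a \<Rightarrow> 'a"  (infixr \<open>*\<^sub>C\<close> 75)
    and cinner :: "'a \<Rightarrow> 'a \<Rightarrow> complex"
  assumes scaleC_add_right: "c *\<^sub>C (x + y) = c *\<^sub>C x + c *\<^sub>C y"
    and scaleC_add_left: "(c + d) *\<^sub>C x = c *\<^sub>C x + d *\<^sub>C x"
    and scaleC_scaleC: "c *\<^sub>C d *\<^sub>C x = (c * d) *\<^sub>C x"
    and scaleC_of_real: "complex_of_real r *\<^sub>C x = r *\<^sub>R x"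
    and cinner_commute: "cinner x y = cnj (cinner y x)"
    and cinner_add_left: "cinner (x + y) z = cinner x z + cinner y z"
    and cinner_scaleC_left: "cinner (c *\<^sub>C x) y = c * cinner x y"
    and cinner_self_nonneg: "0 \<le> Re (cinner x x)"
    and norm_eq_sqrt_cinner: "norm x = sqrt (Re (cinner x x))"

lemma norm_scaleC: "norm (c *\<^sub>C (x::'a::complex_hilbert)) = cmod c * norm x"
proof -
  have "cinner (c *\<^sub>C x) (c *\<^sub>C x) = c * cnj (cinner (c *\<^sub>C x) x)"
    by (metis cinner_commute cinner_scaleC_left)
  also have "\<dots> = (c * cnj c) * cinner x x"
    by (metis cinner_commute cinner_scaleC_left complex_cnj_mult mult.assoc)
  also have "\<dots> = complex_of_real ((cmod c)\<^sup>2) * cinner x x"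
    by (simp only: complex_norm_square)
  finally have "Re (cinner (c *\<^sub>C x) (c *\<^sub>C x)) = (cmod c)\<^sup>2 * Re (cinner x x)"
    by (metis Re_complex_of_real Im_complex_of_real diff_zero mult_zero_left times_complex.sel(1))
  then show ?thesis
    by (simp add: norm_eq_sqrt_cinner real_sqrt_mult)
qed

lemma bounded_linear_scaleC: "bounded_linear ((*\<^sub>C) c :: 'a::complex_hilbert \<Rightarrow> 'a)"
proof (rule bounded_linear_intro[where K = "cmod c"])
  fix r and x y :: 'a
  show "c *\<^sub>C (x + y) = c *\<^sub>C x + c *\<^sub>C y"
    by (rule scaleC_add_right)
  show "c *\<^sub>C r *\<^sub>R x = r *\<^sub>R c *\<^sub>C x"
    by (metis scaleC_of_real scaleC_scaleC mult.commute)
  show "norm (c *\<^sub>C x) \<le> norm x * cmod c"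
    by (simp add: norm_scaleC)
qed


section \<open>The algebra $B(H)$ and its closed subalgebras\<close>

text \<open>
  Elements of the type \<open>'h \<Rightarrow>\<^sub>L 'h\<close> are merely real linear; $B(H)$ consists of the complex
  linear ones, with the operator norm of that type and multiplication \<open>o\<^sub>L\<close>.
\<close>

definition bounded_ops :: "('h::complex_hilbert \<Rightarrow>\<^sub>L 'h) set" where
  "bounded_ops = {S. \<forall>c x. blinfun_apply S (c *\<^sub>C x) = c *\<^sub>C blinfun_apply S x}"

lift_definition scale_op :: "complex \<Rightarrow> ('h::complex_hilbert \<Rightarrow>\<^sub>L 'h) \<Rightarrow> ('h \<Rightarrow>\<^sub>L 'h)"
  is "\<lambda>c S x. c *\<^sub>C S x"
  by (rule bounded_linear_compose[OF bounded_linear_scaleC])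

definition closed_subalgebra :: "('h::complex_hilbert \<Rightarrow>\<^sub>L 'h) set \<Rightarrow> bool" where
  "closed_subalgebra A \<longleftrightarrow> A \<subseteq> bounded_ops \<and> closed A \<and> 0 \<in> A \<and>
     (\<forall>a\<in>A. \<forall>b\<in>A. a + b \<in> A) \<and> (\<forall>c. \<forall>a\<in>A. scale_op c a \<in> A) \<and>
     (\<forall>a\<in>A. \<forall>b\<in>A. a o\<^sub>L b \<in> A)"

definition closed_algebra :: "('h::complex_hilbert \<Rightarrow>\<^sub>L 'h) set \<Rightarrow> ('h \<Rightarrow>\<^sub>L 'h) set" where
  "closed_algebra S = closed_subalgebra hull S"

lemma closed_subalgebra_bounded_ops:
  "closed_subalgebra (bounded_ops :: ('h::complex_hilbert \<Rightarrow>\<^sub>L 'h) set)"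
proof -
  have "closed (bounded_ops :: ('h \<Rightarrow>\<^sub>L 'h) set)"
    unfolding bounded_ops_def
    by (intro closed_Collect_all closed_Collect_eq continuous_intros
        bounded_linear.continuous_on[OF bounded_linear_scaleC])
  moreover have "c *\<^sub>C (0::'h) = 0" for c
    using bounded_linear_scaleC[THEN linear_simps(3)] .
  ultimately show ?thesis
    by (auto simp: closed_subalgebra_def bounded_ops_def plus_blinfun.rep_eq
        scale_op.rep_eq scaleC_add_right scaleC_scaleC mult.commute)
qed


section \<open>Spectrum and analytic functional calculus\<close>

definition is_resolvent_at ::
    "('h::complex_hilbert \<Rightarrow>\<^sub>L 'h) \<Rightarrow> complex \<Rightarrow> ('h \<Rightarrow>\<^sub>L 'h) \<Rightarrow> bool" where
  "is_resolvent_at T z R \<longleftrightarrow> R \<in> bounded_ops \<and>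
     R o\<^sub>L (scale_op z id_blinfun - T) = id_blinfun \<and>
     (scale_op z id_blinfun - T) o\<^sub>L R = id_blinfun"

definition Sp :: "('h::complex_hilbert \<Rightarrow>\<^sub>L 'h) \<Rightarrow> complex set" where
  "Sp T = {z. \<nexists>R. is_resolvent_at T z R}"

definition resolvent :: "('h::complex_hilbert \<Rightarrow>\<^sub>L 'h) \<Rightarrow> complex \<Rightarrow> ('h \<Rightarrow>\<^sub>L 'h)" where
  "resolvent T z = (THE R. is_resolvent_at T z R)"

text \<open>The operator-valued analogue of \<open>contour_integral\<close>.\<close>

definition op_contour_integral ::
    "(real \<Rightarrow> complex) \<Rightarrow> (complex \<Rightarrow> 'h::complex_hilbert \<Rightarrow>\<^sub>L 'h) \<Rightarrow> ('h \<Rightarrow>\<^sub>L 'h)" where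
  "op_contour_integral \<gamma> F =
     integral {0..1} (\<lambda>t. scale_op (vector_derivative \<gamma> (at t within {0..1})) (F (\<gamma> t)))"

text \<open>
  A cycle is a finite list of closed paths. It surrounds the compact set \<open>K\<close> in the open set
  \<open>U \<supseteq> K\<close> if it runs in \<open>U - K\<close> and has index 1 about the points of \<open>K\<close>
  and index 0 about the points outside \<open>U\<close>.
\<close>

definition surrounds :: "(real \<Rightarrow> complex) list \<Rightarrow> complex set \<Rightarrow> complex set \<Rightarrow> bool" where
  "surrounds \<Gamma> K U \<longleftrightarrow>
     (\<forall>\<gamma>\<in>set \<Gamma>. valid_path \<gamma> \<and> pathfinish \<gamma> = pathstart \<gamma> \<and> path_image \<gamma> \<subseteq> U - K) \<and>
     (\<forall>w\<in>K. (\<Sum>\<gamma>\<leftarrow>\<Gamma>. winding_number \<gamma> w) = 1) \<and>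
     (\<forall>w. w \<notin> U \<longrightarrow> (\<Sum>\<gamma>\<leftarrow>\<Gamma>. winding_number \<gamma> w) = 0)"

text \<open>
  $f(T) = \frac{1}{2 \pi i} \int_\Gamma f(z) (z - T)^{-1} dz$ for \<open>f\<close> holomorphic on the open set
  \<open>U \<supseteq> Sp T\<close>; by Cauchy's theorem the value does not depend on the surrounding cycle chosen.
\<close>

definition analytic_calculus ::
    "('h::complex_hilbert \<Rightarrow>\<^sub>L 'h) \<Rightarrow> complex set \<Rightarrow> (complex \<Rightarrow> complex) \<Rightarrow> ('h \<Rightarrow>\<^sub>L 'h)" where
  "analytic_calculus T U f =
     (let \<Gamma> = (SOME \<Gamma>. surrounds \<Gamma> (Sp T) U) in
      scale_op (1 / (2 * of_real pi * \<i>))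
        (\<Sum>\<gamma>\<leftarrow>\<Gamma>. op_contour_integral \<gamma> (\<lambda>z. scale_op (f z) (resolvent T z))))"

text \<open>
  The function equal to 1 near \<open>\<mu>\<close> and to 0 near the rest of the spectrum is taken to be the
  indicator function of a disc isolating \<open>\<mu>\<close>, on the open set obtained by removing the bounding
  circle from the plane. All admissible radii give the same idempotent.
\<close>

definition minimal_spectral_idempotents ::
    "('h::complex_hilbert \<Rightarrow>\<^sub>L 'h) \<Rightarrow> ('h \<Rightarrow>\<^sub>L 'h) set" where
  "minimal_spectral_idempotents T =
     {analytic_calculus T (ball \<mu> r \<union> - cball \<mu> r) (indicator (ball \<mu> r)) | \<mu> r.
        \<mu> isolated_in Sp T \<and> \<mu> \<noteq> 0 \<and> r > 0 \<and> Sp T \<inter> cball \<mu> r = {\<mu>}}"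


section \<open>Properties of commutative closed subalgebras\<close>

text \<open>
  \<open>A\<close> stands for a commutative closed subalgebra of $B(H)$, so ideals are two-sided. The Jacobson
  radical is the intersection of the maximal modular ideals, to be read as \<open>A\<close> if there are none.
\<close>

definition ideal_of :: "('h::complex_hilbert \<Rightarrow>\<^sub>L 'h) set \<Rightarrow> ('h \<Rightarrow>\<^sub>L 'h) set \<Rightarrow> bool" where
  "ideal_of A I \<longleftrightarrow> I \<subseteq> A \<and> 0 \<in> I \<and> (\<forall>a\<in>I. \<forall>b\<in>I. a + b \<in> I) \<and>
     (\<forall>c. \<forall>a\<in>I. scale_op c a \<in> I) \<and> (\<forall>a\<in>A. \<forall>b\<in>I. a o\<^sub>L b \<in> I \<and> b o\<^sub>L a \<in> I)"

definition modular_ideal :: "('h::complex_hilbert \<Rightarrow>\<^sub>L 'h) set \<Rightarrow> ('h \<Rightarrow>\<^sub>L 'h) set \<Rightarrow> bool" where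
  "modular_ideal A I \<longleftrightarrow> ideal_of A I \<and>
     (\<exists>e\<in>A. \<forall>a\<in>A. a - (e o\<^sub>L a) \<in> I \<and> a - (a o\<^sub>L e) \<in> I)"

definition maximal_modular_ideal ::
    "('h::complex_hilbert \<Rightarrow>\<^sub>L 'h) set \<Rightarrow> ('h \<Rightarrow>\<^sub>L 'h) set \<Rightarrow> bool" where
  "maximal_modular_ideal A M \<longleftrightarrow> modular_ideal A M \<and> M \<noteq> A \<and>
     (\<forall>I. ideal_of A I \<and> M \<subseteq> I \<longrightarrow> I = M \<or> I = A)"

definition jacobson_radical :: "('h::complex_hilbert \<Rightarrow>\<^sub>L 'h) set \<Rightarrow> ('h \<Rightarrow>\<^sub>L 'h) set" where
  "jacobson_radical A = A \<inter> \<Inter> {M. maximal_modular_ideal A M}"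

definition semisimple :: "('h::complex_hilbert \<Rightarrow>\<^sub>L 'h) set \<Rightarrow> bool" where
  "semisimple A \<longleftrightarrow> jacobson_radical A = {0}"

text \<open>
  The dual space of \<open>A\<close>; its elements are functions on the whole type, of which only the
  values on \<open>A\<close> matter.
\<close>

definition dual_of :: "('h::complex_hilbert \<Rightarrow>\<^sub>L 'h) set \<Rightarrow> (('h \<Rightarrow>\<^sub>L 'h) \<Rightarrow> complex) set" where
  "dual_of A = {\<phi>. (\<forall>a\<in>A. \<forall>b\<in>A. \<phi> (a + b) = \<phi> a + \<phi> b) \<and>
     (\<forall>c. \<forall>a\<in>A. \<phi> (scale_op c a) = c * \<phi> a) \<and>
     (\<exists>K. \<forall>a\<in>A. cmod (\<phi> a) \<le> K * norm a)}"

definition weak_topology :: "('h::complex_hilbert \<Rightarrow>\<^sub>L 'h) set \<Rightarrow> ('h \<Rightarrow>\<^sub>L 'h) topology" where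
  "weak_topology A =
     topology_generated_by {{a\<in>A. \<phi> a \<in> V} | \<phi> V. \<phi> \<in> dual_of A \<and> open V}"

definition weakly_compact_operator ::
    "('h::complex_hilbert \<Rightarrow>\<^sub>L 'h) set \<Rightarrow> (('h \<Rightarrow>\<^sub>L 'h) \<Rightarrow> ('h \<Rightarrow>\<^sub>L 'h)) \<Rightarrow> bool" where
  "weakly_compact_operator A L \<longleftrightarrow>
     compactin (weak_topology A) (weak_topology A closure_of (L ` (A \<inter> cball 0 1)))"

definition weakly_compact_algebra :: "('h::complex_hilbert \<Rightarrow>\<^sub>L 'h) set \<Rightarrow> bool" where
  "weakly_compact_algebra A \<longleftrightarrow> (\<forall>a\<in>A. weakly_compact_operator A (\<lambda>b. a o\<^sub>L b))"

text \<open>Nets are rendered by proper filters.\<close>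

definition has_bounded_approximate_identity :: "('h::complex_hilbert \<Rightarrow>\<^sub>L 'h) set \<Rightarrow> bool" where
  "has_bounded_approximate_identity A \<longleftrightarrow>
     (\<exists>F K. F \<noteq> bot \<and> (\<forall>\<^sub>F e in F. e \<in> A \<and> norm e \<le> K) \<and>
        (\<forall>a\<in>A. ((\<lambda>e. e o\<^sub>L a) \<longlongrightarrow> a) F \<and> ((\<lambda>e. a o\<^sub>L e) \<longlongrightarrow> a) F))"

end

theory Submission
  imports Defs
begin

text \<open>
  Write \<open>A\<close> for the closed algebra generated by \<open>T\<close> and \<open>B\<close> for the one generated by the minimal
  spectral idempotents.

  \<open>B \<subseteq> A\<close>: the spectrum is countable, so its complement is connected, and the resolvent stays in
  the closed unital algebra generated by \<open>T\<close>
  (\<open>resolvent_in_closed_subalgebra\<close>). The idempotent \<open>p\<close> at \<open>\<mu> \<noteq> 0\<close> is the integral of the resolvent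
  over a small circle about \<open>\<mu>\<close> (\<open>analytic_calculus_eq_riesz_idempotent\<close>). Since 0 lies outside that
  circle, the Cauchy kernel identity \<open>circle_int_Cauchy_kernel\<close> exhibits \<open>p\<close> as a multiple of \<open>T\<close>, so
  \<open>p\<close> lies in \<open>A\<close> itself.

  \<open>A \<subseteq> B\<close>: the element \<open>(T - \<mu>) p\<close> is quasinilpotent, hence zero by semisimplicity
  (\<open>semisimple_eigenvalue\<close>). So \<open>T p = \<mu> p\<close>, and \<open>T\<close> maps \<open>B\<close> into \<open>B\<close>. Let \<open>e\<close> run through a bounded
  approximate identity of \<open>B\<close>. Weak compactness of multiplication by \<open>T\<close> gives, after scaling to
  the unit ball, a weak cluster point \<open>S\<close> in \<open>A\<close> of \<open>T e\<close>, and \<open>S p = T p\<close> for every idempotent \<open>p\<close>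
  because \<open>e p\<close> tends to \<open>p\<close>. An element of \<open>A\<close> that annihilates all these idempotents lies in the
  radical (\<open>annihilator_in_radical\<close>), so \<open>S = T\<close>. All the \<open>T e\<close> lie in \<open>B\<close>, and a closed subspace is
  weakly closed (\<open>separating_functional\<close>); thus \<open>T\<close> lies in \<open>B\<close>.

  The radical is handled through maximal modular ideals directly. Two observations replace the theory
  of characters: the identity modulo a proper modular ideal is not congruent to any \<open>q\<close> with
  \<open>id - q\<close> invertible (\<open>modular_ideal_improper\<close>), and the identity modulo a maximal modular ideal is
  congruent to a multiple of any given element outside the ideal (\<open>maximal_modular_ideal_generate\<close>).
  The invertible elements that are needed come from Neumann series, whose convergence
  rests on estimates of powers by integrals of the resolvent over circles. These integrals are
  studied through the matrix coefficients \<open>\<langle>S x, y\<rangle>\<close>, which reduce operator-valued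
  statements to scalar complex analysis.
\<close>


section \<open>Matrix coefficients\<close>

lemma cinner_add_right: "cinner (x::'h::complex_hilbert) (y + z) = cinner x y + cinner x z"
  by (metis cinner_add_left cinner_commute complex_cnj_add)

lemma cinner_self: "cinner (x::'h::complex_hilbert) x = of_real ((norm x)\<^sup>2)"
proof -
  have "Im (cinner x x) = 0"
    using arg_cong[OF cinner_commute[of x x], of Im] by simp
  then show ?thesis
    by (simp add: norm_eq_sqrt_cinner cinner_self_nonneg complex_eq_iff)
qed

text \<open>
  The real part is bounded by comparing the expansion of \<open>(norm (x + y))\<^sup>2\<close> with the triangle
  inequality; multiplying \<open>x\<close> by a phase then bounds the modulus.
\<close>

lemma norm_cinner_le: "cmod (cinner (x::'h::complex_hilbert) y) \<le> norm x * norm y"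
proof -
  have Re_le: "Re (cinner u y) \<le> norm u * norm y" for u :: 'h
  proof -
    have "cinner (u + y) (u + y) = cinner u u + cinner y y + (cinner u y + cnj (cinner u y))"
      using cinner_commute[of y u] by (simp add: cinner_add_left cinner_add_right)
    from arg_cong[OF this, of Re]
    have "(norm (u + y))\<^sup>2 = (norm u)\<^sup>2 + (norm y)\<^sup>2 + 2 * Re (cinner u y)"
      by (simp add: cinner_self flip: of_real_power)
    moreover have "(norm (u + y))\<^sup>2 \<le> (norm u + norm y)\<^sup>2"
      by (simp add: norm_triangle_ineq power_mono)
    ultimately show ?thesis
      by (simp add: power2_sum)
  qed
  define c where "c = cnj (sgn (cinner x y))"
  have "Re (cinner (c *\<^sub>C x) y) = cmod (cinner x y)"
    by (simp add: c_def cinner_scaleC_left sgn_eq complex_norm_square power2_eq_square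
        mult.commute[of "cnj _"] flip: complex_norm_square)
  moreover have "norm (c *\<^sub>C x) \<le> norm x"
    by (simp add: norm_scaleC c_def norm_sgn)
  ultimately show ?thesis
    by (metis Re_le order_trans mult_right_mono norm_ge_zero)
qed

text \<open>
  Matrix coefficients separate operators and control their norm, so they play the part of the dual
  space of \<open>B(H)\<close> wherever a scalar theorem of complex analysis is to be transferred to operators.
\<close>

definition coef :: "'h::complex_hilbert \<Rightarrow> 'h \<Rightarrow> ('h \<Rightarrow>\<^sub>L 'h) \<Rightarrow> complex" where
  "coef x y S = cinner (blinfun_apply S x) y"

lemma norm_coef_le: "cmod (coef x y S) \<le> norm S * (norm x * norm y)"
proof -
  have "cmod (coef x y S) \<le> norm (S x) * norm y"
    unfolding coef_def by (rule norm_cinner_le)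
  also have "\<dots> \<le> (norm S * norm x) * norm y"
    by (intro mult_right_mono norm_blinfun norm_ge_zero)
  finally show ?thesis by (simp add: mult.assoc)
qed

lemma coef_scale_op: "coef x y (scale_op c S) = c * coef x y S"
  by (simp add: coef_def scale_op.rep_eq cinner_scaleC_left)

lemma bounded_linear_coef: "bounded_linear (coef x y)"
proof (rule bounded_linear_intro[where K = "norm x * norm y"])
  show "coef x y (r *\<^sub>R S) = r *\<^sub>R coef x y S" for r S
    by (simp add: coef_def blinfun.scaleR_left cinner_scaleC_left scaleR_conv_of_real
        flip: scaleC_of_real)
qed (auto simp: coef_def blinfun.add_left cinner_add_left norm_coef_le[unfolded coef_def])

lemmas coef_simps = linear_simps[OF bounded_linear_coef] coef_scale_op

text \<open>
  It suffices to test with \<open>y = S x\<close>.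
\<close>

lemma norm_le_if_coef_le:
  assumes "\<And>x y. cmod (coef x y S) \<le> C * (norm x * norm y)" "0 \<le> C"
  shows "norm S \<le> C"
proof (rule norm_blinfun_bound)
  fix x
  have "(norm (S x))\<^sup>2 \<le> C * norm x * norm (S x)"
    using assms(1)[of x "S x"] by (simp add: coef_def cinner_self norm_power mult.assoc)
  then show "norm (S x) \<le> C * norm x"
    by (cases "S x = 0") (use assms(2) in \<open>simp_all add: power2_eq_square\<close>)
qed fact

lemma eq_if_coef_eq:
  assumes "\<And>x y. coef x y S = coef x y S'"
  shows "S = S'"
proof -
  have "norm (S - S') \<le> 0"
    by (rule norm_le_if_coef_le) (simp_all add: coef_simps assms)
  then show ?thesis by simp
qed


section \<open>Arithmetic in the algebra of bounded operators\<close>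

lemma id_in_bounded_ops: "id_blinfun \<in> bounded_ops"
  by (simp add: bounded_ops_def)

lemma scaleC_zero_right [simp]: "c *\<^sub>C (0::'h::complex_hilbert) = 0"
  using bounded_linear_scaleC[THEN linear_simps(3)] .

lemma scaleC_one [simp]: "1 *\<^sub>C (x::'h::complex_hilbert) = x"
  using scaleC_of_real[of 1 x] by simp

lemma scaleC_minus_left: "(- c) *\<^sub>C (x::'h::complex_hilbert) = - (c *\<^sub>C x)"
  by (metis mult_minus1 scaleC_of_real scaleC_scaleC of_real_minus of_real_1 scaleR_minus1_left)

lemma scaleC_zero_left [simp]: "0 *\<^sub>C (x::'h::complex_hilbert) = 0"
  using scaleC_of_real[of 0 x] by simp

lemma scale_op_compose: "scale_op c S o\<^sub>L R = scale_op c (S o\<^sub>L R)"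
  by (rule blinfun_eqI) (simp add: scale_op.rep_eq)

lemma compose_scale_op: "S \<in> bounded_ops \<Longrightarrow> S o\<^sub>L scale_op c R = scale_op c (S o\<^sub>L R)"
  by (rule blinfun_eqI) (simp add: scale_op.rep_eq bounded_ops_def)

lemma scale_op_scale_op [simp]: "scale_op c (scale_op d S) = scale_op (c * d) S"
  by (rule blinfun_eqI) (simp add: scale_op.rep_eq scaleC_scaleC)

lemma scale_op_one [simp]: "scale_op 1 S = S"
  by (rule blinfun_eqI) (simp add: scale_op.rep_eq)

lemma scale_op_zero_left [simp]: "scale_op 0 S = 0"
  by (rule blinfun_eqI) (simp add: scale_op.rep_eq)

lemma scale_op_zero_right [simp]: "scale_op c 0 = 0"
  by (rule blinfun_eqI) (simp add: scale_op.rep_eq)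

lemma scale_op_minus_one: "scale_op (-1) S = - S"
  by (rule blinfun_eqI) (simp add: scale_op.rep_eq scaleC_minus_left blinfun.minus_left)

lemma scale_op_of_real: "scale_op (of_real r) S = r *\<^sub>R S"
  by (rule blinfun_eqI) (simp add: scale_op.rep_eq scaleC_of_real blinfun.scaleR_left)

lemma norm_scale_op: "norm (scale_op c S) = cmod c * norm S"
proof -
  have le: "norm (scale_op d R) \<le> cmod d * norm R" for d :: complex and R :: "'a \<Rightarrow>\<^sub>L 'a"
  proof (rule norm_blinfun_bound)
    show "norm (scale_op d R x) \<le> cmod d * norm R * norm x" for x
      by (simp add: scale_op.rep_eq norm_scaleC norm_blinfun mult.assoc mult_left_mono)
  qed simp
  show ?thesis
  proof (cases "c = 0")
    case False
    have "norm S = norm (scale_op (1 / c) (scale_op c S))" using False by simp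
    also have "\<dots> \<le> norm (scale_op c S) / cmod c"
      using le[of "1 / c" "scale_op c S"] by (simp add: norm_divide)
    finally show ?thesis using le[of c S] False by (simp add: field_simps)
  qed simp
qed

lemma bounded_bilinear_scale_op: "bounded_bilinear scale_op"
proof (rule bounded_bilinear.intro)
  show "\<exists>K. \<forall>a b. norm (scale_op a b) \<le> norm a * norm b * K"
    by (rule exI[of _ 1]) (simp add: norm_scale_op)
  show "scale_op (r *\<^sub>R a) b = r *\<^sub>R scale_op a b" for r a b
    by (simp add: scaleR_conv_of_real flip: scale_op_of_real)
  show "scale_op a (r *\<^sub>R b) = r *\<^sub>R scale_op a b" for r a b
    by (simp add: mult.commute flip: scale_op_of_real)
qed (auto intro!: blinfun_eqI simp: scale_op.rep_eq blinfun.add_left scaleC_add_left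
    scaleC_add_right)

lemmas scale_op_simps =
  bounded_bilinear.add_left[OF bounded_bilinear_scale_op]
  bounded_bilinear.add_right[OF bounded_bilinear_scale_op]
  bounded_bilinear.diff_left[OF bounded_bilinear_scale_op]
  bounded_bilinear.diff_right[OF bounded_bilinear_scale_op]
  bounded_bilinear.minus_left[OF bounded_bilinear_scale_op]
  bounded_bilinear.minus_right[OF bounded_bilinear_scale_op]

lemmas compose_simps =
  bounded_bilinear.add_left[OF bounded_bilinear_blinfun_compose]
  bounded_bilinear.add_right[OF bounded_bilinear_blinfun_compose]
  bounded_bilinear.diff_left[OF bounded_bilinear_blinfun_compose]
  bounded_bilinear.diff_right[OF bounded_bilinear_blinfun_compose]
  bounded_bilinear.minus_left[OF bounded_bilinear_blinfun_compose]
  bounded_bilinear.minus_right[OF bounded_bilinear_blinfun_compose]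

lemma compose_assoc: "(a o\<^sub>L b) o\<^sub>L c = a o\<^sub>L (b o\<^sub>L c)"
  by (rule blinfun_eqI) simp

lemma compose_id [simp]: "id_blinfun o\<^sub>L a = a" "a o\<^sub>L id_blinfun = a"
  by (rule blinfun_eqI, simp)+

lemma closed_subalgebraD:
  assumes "closed_subalgebra A"
  shows "A \<subseteq> bounded_ops" "closed A" "0 \<in> A"
    "a \<in> A \<Longrightarrow> b \<in> A \<Longrightarrow> a + b \<in> A" "a \<in> A \<Longrightarrow> scale_op c a \<in> A"
    "a \<in> A \<Longrightarrow> b \<in> A \<Longrightarrow> a o\<^sub>L b \<in> A"
    "a \<in> A \<Longrightarrow> - a \<in> A" "a \<in> A \<Longrightarrow> b \<in> A \<Longrightarrow> a - b \<in> A" "a \<in> A \<Longrightarrow> r *\<^sub>R a \<in> A"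
proof -
  note A = assms[unfolded closed_subalgebra_def]
  show "A \<subseteq> bounded_ops" "closed A" "0 \<in> A"
    "a \<in> A \<Longrightarrow> b \<in> A \<Longrightarrow> a + b \<in> A" "a \<in> A \<Longrightarrow> scale_op c a \<in> A"
    "a \<in> A \<Longrightarrow> b \<in> A \<Longrightarrow> a o\<^sub>L b \<in> A"
    using A by blast+
  show m: "a \<in> A \<Longrightarrow> - a \<in> A" for a
    using A by (metis scale_op_minus_one)
  show "a \<in> A \<Longrightarrow> b \<in> A \<Longrightarrow> a - b \<in> A"
    using A m by (metis diff_conv_add_uminus)
  show "a \<in> A \<Longrightarrow> r *\<^sub>R a \<in> A"
    using A by (metis scale_op_of_real)
qed

lemma closed_subalgebra_subspace: "closed_subalgebra A \<Longrightarrow> subspace A"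
  by (simp add: subspace_def closed_subalgebraD)

lemma closed_algebra_properties:
  assumes "S \<subseteq> bounded_ops"
  shows "closed_subalgebra (closed_algebra S)" "S \<subseteq> closed_algebra S"
    "closed_subalgebra A \<Longrightarrow> S \<subseteq> A \<Longrightarrow> closed_algebra S \<subseteq> A"
proof -
  let ?F = "{A. closed_subalgebra A \<and> S \<subseteq> A}"
  have "closed_subalgebra (\<Inter> ?F)"
  proof (subst closed_subalgebra_def, intro conjI)
    show "\<Inter> ?F \<subseteq> bounded_ops"
      using closed_subalgebra_bounded_ops assms by blast
    show "closed (\<Inter> ?F)"
      by (intro closed_Inter) (auto dest: closed_subalgebraD(2))
  qed (auto simp: closed_subalgebraD)
  then show "closed_subalgebra (closed_algebra S)"
    by (simp add: closed_algebra_def hull_def)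
  show "S \<subseteq> closed_algebra S"
    by (simp add: closed_algebra_def hull_subset)
  show "closed_subalgebra A \<Longrightarrow> S \<subseteq> A \<Longrightarrow> closed_algebra S \<subseteq> A"
    by (simp add: closed_algebra_def hull_minimal)
qed

text \<open>
  Applied twice, first with the generator and then with the algebra that it generates, this
  yields commutativity.
\<close>

lemma closed_commutant:
  assumes "S \<subseteq> bounded_ops"
  shows "closed_subalgebra {a \<in> bounded_ops. \<forall>s\<in>S. a o\<^sub>L s = s o\<^sub>L a}" (is "closed_subalgebra ?C")
proof -
  note b = closed_subalgebraD[OF closed_subalgebra_bounded_ops]
  have "?C = bounded_ops \<inter> (\<Inter>s\<in>S. {a. a o\<^sub>L s = s o\<^sub>L a})" by auto
  also have "closed \<dots>"
    by (intro closed_Int closed_subalgebraD(2)[OF closed_subalgebra_bounded_ops] closed_INT ballI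
        closed_Collect_eq continuous_intros)
  finally have "closed ?C" .
  moreover have "a o\<^sub>L b \<in> ?C" if ab: "a \<in> ?C" "b \<in> ?C" for a b
  proof (intro CollectI conjI ballI)
    show "a o\<^sub>L b \<in> bounded_ops"
      using ab b(6) by blast
    show "a o\<^sub>L b o\<^sub>L s = s o\<^sub>L (a o\<^sub>L b)" if "s \<in> S" for s
    proof -
      have "a o\<^sub>L b o\<^sub>L s = a o\<^sub>L (s o\<^sub>L b)"
        using ab that by (simp add: compose_assoc)
      also have "\<dots> = s o\<^sub>L (a o\<^sub>L b)"
        using ab that by (simp flip: compose_assoc)
      finally show ?thesis .
    qed
  qed
  moreover have "scale_op c a \<in> ?C" if "a \<in> ?C" for a c
    using that assms b(5) by (auto simp: scale_op_compose compose_scale_op subset_iff)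
  moreover have "a + b \<in> ?C" if "a \<in> ?C" "b \<in> ?C" for a b
    using that b(4) by (auto simp: compose_simps)
  moreover have "0 \<in> ?C"
    using b(3) by auto
  ultimately show ?thesis
    unfolding closed_subalgebra_def by (intro conjI ballI allI) auto
qed


section \<open>Neumann series\<close>

primrec op_power :: "('h::complex_hilbert \<Rightarrow>\<^sub>L 'h) \<Rightarrow> nat \<Rightarrow> ('h \<Rightarrow>\<^sub>L 'h)" where
  "op_power a 0 = id_blinfun"
| "op_power a (Suc n) = a o\<^sub>L op_power a n"

lemma norm_op_power_le: "norm (op_power a n) \<le> norm a ^ n"
  by (induction n)
    (auto simp: norm_blinfun_id_le intro!: order_trans[OF norm_blinfun_compose] mult_left_mono)

lemma op_power_commute: "op_power a n o\<^sub>L a = a o\<^sub>L op_power a n"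
  by (induction n) (simp_all add: compose_assoc)

lemma op_power_in:
  assumes "closed_subalgebra A" "id_blinfun \<in> A" "a \<in> A"
  shows "op_power a n \<in> A"
  by (induction n) (use assms in \<open>simp_all add: closed_subalgebraD\<close>)

lemma Neumann_series:
  assumes A: "closed_subalgebra A" "id_blinfun \<in> A" "a \<in> A"
    and "summable (\<lambda>n. norm (op_power a n))"
  shows "\<exists>v\<in>A. v o\<^sub>L (id_blinfun - a) = id_blinfun \<and> (id_blinfun - a) o\<^sub>L v = id_blinfun \<and>
    norm v \<le> (\<Sum>n. norm (op_power a n))"
proof -
  define v where "v = (\<Sum>n. op_power a n)"
  have sm: "summable (op_power a)"
    using assms(4) by (rule summable_norm_cancel)
  then have lim: "(\<lambda>n. \<Sum>i<n. op_power a i) \<longlonglongrightarrow> v"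
    unfolding v_def by (rule summable_LIMSEQ)
  have "(\<Sum>i<n. op_power a i) \<in> A" for n
    by (intro subspace_sum closed_subalgebra_subspace A(1) op_power_in A)
  then have "v \<in> A"
    by (rule closed_sequentially[OF closed_subalgebraD(2)[OF A(1)] _ lim])
  have tele: "(\<Sum>i<n. op_power a i) o\<^sub>L (id_blinfun - a) = id_blinfun - op_power a n"
    "(id_blinfun - a) o\<^sub>L (\<Sum>i<n. op_power a i) = id_blinfun - op_power a n" for n
  proof (induction n)
    case (Suc n)
    have "op_power a n o\<^sub>L (id_blinfun - a) = op_power a n - op_power a (Suc n)"
      "(id_blinfun - a) o\<^sub>L op_power a n = op_power a n - op_power a (Suc n)"
      by (simp_all add: compose_simps(3,4) op_power_commute)
    then show "(\<Sum>i<Suc n. op_power a i) o\<^sub>L (id_blinfun - a) = id_blinfun - op_power a (Suc n)"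
      "(id_blinfun - a) o\<^sub>L (\<Sum>i<Suc n. op_power a i) = id_blinfun - op_power a (Suc n)"
      using Suc by (simp_all add: compose_simps(1,2))
  qed simp_all
  have lim1: "(\<lambda>n. id_blinfun - op_power a n) \<longlonglongrightarrow> id_blinfun - 0"
    using sm by (intro tendsto_intros summable_LIMSEQ_zero)
  have "v o\<^sub>L (id_blinfun - a) = id_blinfun - 0"
    by (rule LIMSEQ_unique[OF _ lim1], unfold tele(1)[symmetric]) (intro tendsto_intros lim)
  moreover have "(id_blinfun - a) o\<^sub>L v = id_blinfun - 0"
    by (rule LIMSEQ_unique[OF _ lim1], unfold tele(2)[symmetric]) (intro tendsto_intros lim)
  moreover have "norm v \<le> (\<Sum>n. norm (op_power a n))"
    unfolding v_def by (rule summable_norm[OF assms(4)])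
  ultimately show ?thesis using \<open>v \<in> A\<close> by auto
qed

lemma Neumann_series_contraction:
  assumes A: "closed_subalgebra A" "id_blinfun \<in> A" "a \<in> A" and "norm a < 1"
  shows "\<exists>v\<in>A. v o\<^sub>L (id_blinfun - a) = id_blinfun \<and> (id_blinfun - a) o\<^sub>L v = id_blinfun \<and>
    norm v \<le> 1 / (1 - norm a)"
proof -
  have geo: "summable (\<lambda>n. norm a ^ n)"
    using assms(4) by (simp add: summable_geometric)
  have sm: "summable (\<lambda>n. norm (op_power a n))"
    by (rule summable_comparison_test[OF _ geo]) (auto intro!: norm_op_power_le)
  have "(\<Sum>n. norm (op_power a n)) \<le> 1 / (1 - norm a)"
    using suminf_le[OF norm_op_power_le sm geo] assms(4) by (simp add: suminf_geometric)
  then show ?thesis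
    using Neumann_series[OF A sm] by (meson order_trans)
qed

section \<open>The resolvent\<close>

lemma is_resolvent_at_unique:
  assumes "is_resolvent_at T z R" "is_resolvent_at T z R'"
  shows "R = R'"
proof -
  have "R = R o\<^sub>L ((scale_op z id_blinfun - T) o\<^sub>L R')"
    using assms(2) by (simp add: is_resolvent_at_def)
  also have "\<dots> = R'"
    using assms(1) by (simp add: is_resolvent_at_def flip: compose_assoc)
  finally show ?thesis .
qed

lemma resolventI:
  assumes "is_resolvent_at T z R"
  shows "z \<notin> Sp T" "resolvent T z = R"
proof -
  show "z \<notin> Sp T" using assms by (auto simp: Sp_def)
  show "resolvent T z = R"
    unfolding resolvent_def
    by (rule the_equality[where P = "is_resolvent_at T z"])
      (use assms is_resolvent_at_unique in blast)+
qed

lemma is_resolvent_at_resolvent: "z \<notin> Sp T \<Longrightarrow> is_resolvent_at T z (resolvent T z)"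
proof -
  assume "z \<notin> Sp T"
  then obtain R where "is_resolvent_at T z R" by (auto simp: Sp_def)
  with resolventI(2)[OF this] show ?thesis by simp
qed

lemma resolventD:
  assumes "z \<notin> Sp T"
  shows "resolvent T z \<in> bounded_ops"
    "resolvent T z o\<^sub>L (scale_op z id_blinfun - T) = id_blinfun"
    "(scale_op z id_blinfun - T) o\<^sub>L resolvent T z = id_blinfun"
  using is_resolvent_at_resolvent[OF assms] by (auto simp: is_resolvent_at_def)

lemma compose_resolvent:
  assumes "z \<notin> Sp T"
  shows "T o\<^sub>L resolvent T z = scale_op z (resolvent T z) - id_blinfun"
  using resolventD(3)[OF assms]
  by (simp add: compose_simps scale_op_compose algebra_simps)

lemma resolvent_identity:
  assumes "z \<notin> Sp T" "w \<notin> Sp T"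
  shows "resolvent T z - resolvent T w = scale_op (w - z) (resolvent T z o\<^sub>L resolvent T w)"
proof -
  let ?Z = "scale_op z id_blinfun - T" and ?W = "scale_op w id_blinfun - T"
  have "resolvent T z - resolvent T w
      = (resolvent T z o\<^sub>L (?W o\<^sub>L resolvent T w)) -
        ((resolvent T z o\<^sub>L ?Z) o\<^sub>L resolvent T w)"
    by (simp add: resolventD assms)
  also have "\<dots> = resolvent T z o\<^sub>L ((?W - ?Z) o\<^sub>L resolvent T w)"
    by (simp only: compose_simps compose_assoc)
  also have "?W - ?Z = scale_op (w - z) id_blinfun"
    by (simp add: scale_op_simps)
  also have "resolvent T z o\<^sub>L (scale_op (w - z) id_blinfun o\<^sub>L resolvent T w)
      = scale_op (w - z) (resolvent T z o\<^sub>L resolvent T w)"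
    by (simp add: scale_op_compose compose_scale_op resolventD assms)
  finally show ?thesis .
qed

text \<open>
  Both existence results come from a Neumann series, in the resolvent at \<open>w\<close> and in \<open>T\<close>
  respectively, so the new resolvent lies in every closed subalgebra with identity that contains
  these operators.
\<close>

lemma resolvent_perturbation:
  assumes A: "closed_subalgebra A" "id_blinfun \<in> A"
    and w: "w \<notin> Sp T" "resolvent T w \<in> A" and near: "cmod (z - w) * norm (resolvent T w) < 1"
  shows "z \<notin> Sp T" "resolvent T z \<in> A"
    "norm (resolvent T z) \<le> norm (resolvent T w) / (1 - cmod (z - w) * norm (resolvent T w))"
proof -
  let ?R = "resolvent T w"
  define q where "q = scale_op (w - z) ?R"
  have q: "q \<in> A" "norm q = cmod (z - w) * norm ?R"
    by (simp_all add: q_def closed_subalgebraD A w norm_scale_op norm_minus_commute)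
  obtain v where v: "v \<in> A" "v o\<^sub>L (id_blinfun - q) = id_blinfun"
      "(id_blinfun - q) o\<^sub>L v = id_blinfun" "norm v \<le> 1 / (1 - norm q)"
    using Neumann_series_contraction[OF A q(1)] near unfolding q(2) by blast
  \<comment> \<open>the factor \<open>id - q\<close> is inverted by the Neumann series \<open>v\<close>\<close>
  have fact: "scale_op z id_blinfun - T = (scale_op w id_blinfun - T) o\<^sub>L (id_blinfun - q)"
  proof -
    have wq: "(scale_op w id_blinfun - T) o\<^sub>L q = scale_op (w - z) id_blinfun"
    proof -
      have "(scale_op w id_blinfun - T) o\<^sub>L q =
        (scale_op w id_blinfun - T) o\<^sub>L (?R o\<^sub>L scale_op (w - z) id_blinfun)"
        using w by (simp add: q_def compose_scale_op resolventD)
      also have "\<dots> = scale_op (w - z) id_blinfun"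
        using w by (simp add: resolventD flip: compose_assoc)
      finally show ?thesis .
    qed
    show "scale_op z id_blinfun - T = (scale_op w id_blinfun - T) o\<^sub>L (id_blinfun - q)"
      by (simp add: compose_simps(4) wq scale_op_simps)
  qed
  have "is_resolvent_at T z (v o\<^sub>L ?R)"
    unfolding is_resolvent_at_def
  proof (intro conjI)
    show "v o\<^sub>L ?R \<in> bounded_ops"
      by (rule subsetD[OF closed_subalgebraD(1)[OF A(1)]])
        (use v w closed_subalgebraD(6)[OF A(1)] in blast)
    have "v o\<^sub>L ?R o\<^sub>L (scale_op z id_blinfun - T) =
        v o\<^sub>L (?R o\<^sub>L (scale_op w id_blinfun - T)) o\<^sub>L (id_blinfun - q)"
      by (simp only: fact compose_assoc)
    then show "v o\<^sub>L ?R o\<^sub>L (scale_op z id_blinfun - T) = id_blinfun"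
      using w v by (simp add: resolventD)
    have "(scale_op z id_blinfun - T) o\<^sub>L (v o\<^sub>L ?R) =
        (scale_op w id_blinfun - T) o\<^sub>L ((id_blinfun - q) o\<^sub>L v) o\<^sub>L ?R"
      by (simp only: fact compose_assoc)
    then show "(scale_op z id_blinfun - T) o\<^sub>L (v o\<^sub>L ?R) = id_blinfun"
      using w v by (simp add: resolventD)
  qed
  from resolventI[OF this] show "z \<notin> Sp T" and R: "resolvent T z \<in> A"
    using closed_subalgebraD(6)[OF A(1) v(1) w(2)] by simp_all
  have "norm (v o\<^sub>L ?R) \<le> norm v * norm ?R"
    by (rule norm_blinfun_compose)
  also have "\<dots> \<le> 1 / (1 - norm q) * norm ?R"
    by (intro mult_right_mono v) simp
  finally show "norm (resolvent T z) \<le> norm ?R / (1 - cmod (z - w) * norm ?R)"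
    using resolventI(2)[OF \<open>is_resolvent_at T z _\<close>] by (simp add: q)
qed

lemma resolvent_outside_norm:
  assumes A: "closed_subalgebra A" "id_blinfun \<in> A" "T \<in> A" and z: "norm T < cmod z"
  shows "z \<notin> Sp T" "resolvent T z \<in> A" "norm (resolvent T z) \<le> 1 / (cmod z - norm T)"
proof -
  have "z \<noteq> 0" using z by auto
  define q where "q = scale_op (1 / z) T"
  have q: "q \<in> A" "norm q = norm T / cmod z"
    by (simp_all add: q_def closed_subalgebraD A norm_scale_op norm_divide)
  then obtain v where v: "v \<in> A" "v o\<^sub>L (id_blinfun - q) = id_blinfun"
      "(id_blinfun - q) o\<^sub>L v = id_blinfun" "norm v \<le> 1 / (1 - norm q)"
    using Neumann_series_contraction[OF A(1,2) q(1)] z \<open>z \<noteq> 0\<close> by auto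
  have b: "v \<in> bounded_ops" "id_blinfun - q \<in> bounded_ops"
    by (rule subsetD[OF closed_subalgebraD(1)[OF A(1)]],
        use A v q closed_subalgebraD(8)[OF A(1)] in blast)+
  have fact: "scale_op z id_blinfun - T = scale_op z (id_blinfun - q)"
    using \<open>z \<noteq> 0\<close> by (simp add: q_def scale_op_simps)
  have res: "is_resolvent_at T z (scale_op (1 / z) v)"
    unfolding is_resolvent_at_def fact using \<open>z \<noteq> 0\<close> v b
    by (simp add: closed_subalgebraD(5)[OF closed_subalgebra_bounded_ops] scale_op_compose
        compose_scale_op)
  from resolventI[OF this] show "z \<notin> Sp T" "resolvent T z \<in> A"
    using closed_subalgebraD(5)[OF A(1) v(1)] by simp_all
  have "norm (scale_op (1 / z) v) \<le> 1 / cmod z * (1 / (1 - norm q))"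
    unfolding norm_scale_op using v(4) by (intro mult_mono) (auto simp: norm_divide)
  also have "\<dots> = 1 / (cmod z - norm T)"
    using \<open>z \<noteq> 0\<close> by (simp add: q field_simps)
  finally show "norm (resolvent T z) \<le> 1 / (cmod z - norm T)"
    using resolventI(2)[OF res] by simp
qed

lemma open_resolvent_set: "open (- Sp T)"
proof (rule openI)
  fix w assume w: "w \<in> - Sp T"
  define d where "d = 1 / (norm (resolvent T w) + 1)"
  have "z \<in> - Sp T" if "z \<in> ball w d" for z
  proof -
    have "cmod (z - w) * norm (resolvent T w) \<le> d * norm (resolvent T w)"
      using that by (intro mult_right_mono) (auto simp: dist_norm norm_minus_commute)
    also have "\<dots> < 1" by (simp add: d_def field_simps add_pos_nonneg)
    finally show ?thesis
      using resolvent_perturbation(1)[OF closed_subalgebra_bounded_ops id_in_bounded_ops]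
        w resolventD(1) by blast
  qed
  moreover have "d > 0" by (simp add: d_def add_nonneg_pos)
  ultimately show "\<exists>e>0. ball w e \<subseteq> - Sp T" by blast
qed

lemma compact_Sp: "T \<in> bounded_ops \<Longrightarrow> compact (Sp T)"
proof -
  assume T: "T \<in> bounded_ops"
  have "cmod z \<le> norm T" if "z \<in> Sp T" for z
    using resolvent_outside_norm(1)[OF closed_subalgebra_bounded_ops id_in_bounded_ops T] that
    by force
  then have "bounded (Sp T)" by (auto simp: bounded_iff)
  then show ?thesis
    using open_resolvent_set[of T] by (simp add: compact_eq_bounded_closed closed_def)
qed

lemma continuous_on_resolvent: "continuous_on (- Sp T) (resolvent T)"
proof (rule continuous_at_imp_continuous_on, intro ballI)
  fix w assume w: "w \<in> - Sp T"
  let ?R = "norm (resolvent T w)"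
  have ev: "\<forall>\<^sub>F z in at w. norm (resolvent T z - resolvent T w)
      \<le> cmod (z - w) * (2 * ?R * ?R)"
  proof -
    define d where "d = 1 / (2 * (?R + 1))"
    have "norm (resolvent T z - resolvent T w) \<le> cmod (z - w) * (2 * ?R * ?R)"
      if "dist z w < d" for z
    proof -
      have "cmod (z - w) * ?R \<le> d * ?R"
        using that by (intro mult_right_mono) (auto simp: dist_norm norm_minus_commute)
      also have "\<dots> \<le> 1 / 2" by (simp add: d_def divide_le_eq add_nonneg_pos)
      finally have half: "cmod (z - w) * ?R \<le> 1 / 2" .
      then have z: "z \<notin> Sp T" "norm (resolvent T z) \<le> ?R / (1 - cmod (z - w) * ?R)"
        using resolvent_perturbation[OF closed_subalgebra_bounded_ops id_in_bounded_ops,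
          of w T z] w resolventD(1)[of w T] by auto
      note z(2)
      also have "?R / (1 - cmod (z - w) * ?R) \<le> ?R / (1 / 2)"
        using half by (intro divide_left_mono) auto
      finally have *: "norm (resolvent T z) \<le> 2 * ?R" by simp
      have "norm (resolvent T z - resolvent T w)
          = cmod (z - w) * norm (resolvent T z o\<^sub>L resolvent T w)"
        using resolvent_identity[OF z(1)] w by (simp add: norm_scale_op norm_minus_commute)
      also have "\<dots> \<le> cmod (z - w) * (norm (resolvent T z) * ?R)"
        by (intro mult_left_mono norm_blinfun_compose) simp
      also have "\<dots> \<le> cmod (z - w) * (2 * ?R * ?R)"
        by (intro mult_left_mono mult_right_mono *) auto
      finally show ?thesis .
    qed
    moreover have "d > 0" by (simp add: d_def add_nonneg_pos)
    ultimately show ?thesis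
      unfolding eventually_at by blast
  qed
  have "((\<lambda>z. cmod (z - w) * (2 * ?R * ?R)) \<longlongrightarrow> cmod (w - w) * (2 * ?R * ?R)) (at w)"
    by (intro tendsto_intros)
  then have "((\<lambda>z. resolvent T z - resolvent T w) \<longlongrightarrow> 0) (at w)"
    by (intro Lim_null_comparison[OF ev]) simp
  then show "isCont (resolvent T) w"
    unfolding isCont_def by (rule LIM_zero_cancel)
qed

text \<open>
  By the resolvent identity the derivative is minus the coefficient of the squared resolvent.
\<close>

lemma coef_resolvent_holomorphic: "(\<lambda>z. coef x y (resolvent T z)) holomorphic_on - Sp T"
proof (rule holomorphic_onI)
  fix w assume w: "w \<in> - Sp T"
  have "(resolvent T \<longlongrightarrow> resolvent T w) (at w)"
    using continuous_on_resolvent[of T] open_resolvent_set[of T] w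
    by (simp add: continuous_on_eq_continuous_at isCont_def)
  then have "((\<lambda>z. resolvent T z o\<^sub>L resolvent T w) \<longlongrightarrow> (resolvent T w o\<^sub>L resolvent T w)) (at w)"
    by (intro tendsto_intros)
  then have "((\<lambda>z. - coef x y (resolvent T z o\<^sub>L resolvent T w))
      \<longlongrightarrow> - coef x y (resolvent T w o\<^sub>L resolvent T w)) (at w)"
    by (intro tendsto_minus bounded_linear.tendsto[OF bounded_linear_coef])
  moreover have "\<forall>\<^sub>F z in at w. - coef x y (resolvent T z o\<^sub>L resolvent T w)
      = (coef x y (resolvent T z) - coef x y (resolvent T w)) / (z - w)"
  proof (rule eventually_rev_mp[OF eventually_at_in_open[OF open_resolvent_set w]])
    show "\<forall>\<^sub>F z in at w. z \<in> - Sp T - {w} \<longrightarrow> - coef x y (resolvent T z o\<^sub>L resolvent T w)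
      = (coef x y (resolvent T z) - coef x y (resolvent T w)) / (z - w)"
    proof (intro always_eventually allI impI)
      fix z assume z: "z \<in> - Sp T - {w}"
      then have "coef x y (resolvent T z) - coef x y (resolvent T w)
          = (w - z) * coef x y (resolvent T z o\<^sub>L resolvent T w)"
        using resolvent_identity[of z T w] w
        by (metis ComplD Diff_iff coef_simps(2) coef_scale_op)
      then show "- coef x y (resolvent T z o\<^sub>L resolvent T w)
          = (coef x y (resolvent T z) - coef x y (resolvent T w)) / (z - w)"
        using z by (simp add: field_simps)
    qed
  qed
  ultimately have "((\<lambda>z. coef x y (resolvent T z)) has_field_derivative
      - coef x y (resolvent T w o\<^sub>L resolvent T w)) (at w)"
    unfolding has_field_derivative_iff by (rule Lim_transform_eventually)
  then show "(\<lambda>z. coef x y (resolvent T z)) field_differentiable at w within - Sp T"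
    by (auto simp: field_differentiable_def intro: DERIV_subset)
qed

text \<open>
  The set of points at which the resolvent lies in \<open>A\<close> is open and relatively closed in the
  resolvent set. A countable set does not disconnect the plane.
\<close>

lemma resolvent_in_closed_subalgebra:
  assumes A: "closed_subalgebra A" "id_blinfun \<in> A" "T \<in> A" and "countable (Sp T)"
    and z: "z \<notin> Sp T"
  shows "resolvent T z \<in> A"
proof -
  let ?W = "{w \<in> - Sp T. resolvent T w \<in> A}"
  have "connected (- Sp T)"
    by (intro path_connected_imp_connected path_connected_complement_countable) (use assms in auto)
  moreover have "open ?W"
  proof (rule openI)
    fix w assume w: "w \<in> ?W"
    define d where "d = 1 / (norm (resolvent T w) + 1)"
    have "z \<in> ?W" if "z \<in> ball w d" for z
    proof -
      have "cmod (z - w) * norm (resolvent T w) \<le> d * norm (resolvent T w)"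
        using that by (intro mult_right_mono) (auto simp: dist_norm norm_minus_commute)
      also have "\<dots> < 1" by (simp add: d_def field_simps add_pos_nonneg)
      finally show ?thesis
        using resolvent_perturbation[OF A(1,2)] w by blast
    qed
    moreover have "d > 0" by (simp add: d_def add_nonneg_pos)
    ultimately show "\<exists>e>0. ball w e \<subseteq> ?W" by blast
  qed
  moreover have "open (- Sp T - ?W)"
  proof -
    have "- Sp T - ?W = - Sp T \<inter> resolvent T -` (- A)" by auto
    then show ?thesis
      using continuous_open_preimage[OF continuous_on_resolvent open_resolvent_set, of "- A" T]
        closed_subalgebraD(2)[OF A(1)] by (simp add: open_closed)
  qed
  moreover have "?W \<noteq> {}"
  proof -
    have "of_real (norm T + 1) \<in> ?W"
      using resolvent_outside_norm[OF A, of "of_real (norm T + 1)"] by (simp del: of_real_add)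
    then show ?thesis by blast
  qed
  ultimately have "- Sp T - ?W = {}"
    unfolding connected_def by blast
  then show ?thesis using z by blast
qed

section \<open>Operator-valued contour integrals\<close>

text \<open>
  Matrix coefficients reduce this to the scalar case: the integral of \<open>F\<close> along segments from a
  base point has matrix coefficients that are primitives of those of \<open>F\<close>, and the scalar mean
  value inequality is uniform in the two vectors.
\<close>

lemma operator_primitive:
  fixes F :: "complex \<Rightarrow> 'h::complex_hilbert \<Rightarrow>\<^sub>L 'h"
  assumes D: "convex D" "open D" and cont: "continuous_on D F"
    and hol: "\<And>x y. (\<lambda>z. coef x y (F z)) holomorphic_on D"
  obtains P where "\<And>z. z \<in> D \<Longrightarrow> (P has_derivative (\<lambda>h. scale_op h (F z))) (at z)"
proof (cases "D = {}")
  case True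
  then show ?thesis using that[of "\<lambda>_. 0"] by simp
next
  case False
  then obtain w where w: "w \<in> D" by blast
  define P where "P z = integral {0..1} (\<lambda>t. scale_op (z - w) (F (linepath w z t)))" for z
  have seg: "linepath w z ` {0..1} \<subseteq> D" if "z \<in> D" for z
    using closed_segment_subset[OF w that D(1)] path_image_linepath[of w z]
    by (simp add: path_image_def)
  have int: "(\<lambda>t. scale_op (z - w) (F (linepath w z t))) integrable_on {0..1}" if "z \<in> D" for z
    by (intro integrable_continuous_real bounded_bilinear.continuous_on[OF bounded_bilinear_scale_op]
        continuous_on_const continuous_on_compose2[OF cont _ seg[OF that]] continuous_on_linepath)
  have deriv: "(P has_derivative (\<lambda>h. scale_op h (F z))) (at z)" if z: "z \<in> D" for z
    unfolding has_derivative_at_alt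
  proof (intro conjI allI impI)
    show "bounded_linear (\<lambda>h. scale_op h (F z))"
      by (rule bounded_bilinear.bounded_linear_left[OF bounded_bilinear_scale_op])
    fix e :: real assume "e > 0"
    have "isCont F z"
      using cont D(2) z by (simp add: continuous_on_eq_continuous_at)
    then obtain d1 where d1: "d1 > 0" "\<And>u. dist u z < d1 \<Longrightarrow> dist (F u) (F z) < e"
      unfolding continuous_at_eps_delta using \<open>e > 0\<close> by blast
    obtain d2 where d2: "d2 > 0" "ball z d2 \<subseteq> D"
      using D(2) z openE by blast
    define d where "d = min d1 d2"
    have "norm (P u - P z - scale_op (u - z) (F z)) \<le> e * norm (u - z)"
      if u: "norm (u - z) < d" for u
    proof (rule norm_le_if_coef_le)
      fix x y
      obtain g where g: "\<And>z. z \<in> D \<Longrightarrow> (g has_field_derivative coef x y (F z)) (at z within D)"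
        using holomorphic_convex_primitive'[OF D hol[of x y]] by blast
      have coefP: "coef x y (P v) = g v - g w" if v: "v \<in> D" for v
      proof -
        have "((\<lambda>z. coef x y (F z)) has_contour_integral g v - g w) (linepath w v)"
          using contour_integral_primitive[OF g valid_path_linepath, of w v] seg[OF v]
          by (simp add: path_image_def)
        then have "((\<lambda>t. coef x y (F (linepath w v t)) * (v - w)) has_integral g v - g w) {0..1}"
          by (simp add: has_contour_integral_linepath)
        moreover have "((\<lambda>t. coef x y (F (linepath w v t)) * (v - w)) has_integral coef x y (P v)) {0..1}"
          using has_integral_linear[OF integrable_integral[OF int[OF v]] bounded_linear_coef[of x y]]
          by (simp add: P_def comp_def coef_scale_op mult.commute)
        ultimately show ?thesis by (rule has_integral_unique[rotated])
      qed
      have ball: "ball z d \<subseteq> D" using d2 by (auto simp: d_def)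
      have uz: "u \<in> ball z d" "z \<in> ball z d"
        using u d1 d2 by (auto simp: dist_norm norm_minus_commute d_def)
      have "norm ((g u - u * coef x y (F z)) - (g z - z * coef x y (F z)))
          \<le> (e * (norm x * norm y)) * norm (u - z)"
      proof (rule field_differentiable_bound[OF convex_ball _ _ uz])
        fix v assume v: "v \<in> ball z d"
        have "(g has_field_derivative coef x y (F v)) (at v within ball z d)"
          using g v ball DERIV_subset by blast
        then show "((\<lambda>v. g v - v * coef x y (F z)) has_field_derivative
            coef x y (F v) - coef x y (F z)) (at v within ball z d)"
          by (auto intro!: derivative_eq_intros)
        have "cmod (coef x y (F v - F z)) \<le> norm (F v - F z) * (norm x * norm y)"
          by (rule norm_coef_le)
        also have "\<dots> \<le> e * (norm x * norm y)"
          using d1(2)[of v] v by (intro mult_right_mono) (auto simp: d_def dist_norm norm_minus_commute)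
        finally show "cmod (coef x y (F v) - coef x y (F z)) \<le> e * (norm x * norm y)"
          by (simp add: coef_simps)
      qed
      moreover have "coef x y (P u - P z - scale_op (u - z) (F z))
          = (g u - u * coef x y (F z)) - (g z - z * coef x y (F z))"
        using uz ball by (simp add: coef_simps coefP subset_iff algebra_simps)
      ultimately show "cmod (coef x y (P u - P z - scale_op (u - z) (F z)))
          \<le> e * norm (u - z) * (norm x * norm y)"
        by (simp add: mult_ac)
    qed (use \<open>e > 0\<close> in simp)
    then show "\<exists>d>0. \<forall>u. norm (u - z) < d \<longrightarrow>
        norm (P u - P z - scale_op (u - z) (F z)) \<le> e * norm (u - z)"
      using d1 d2 by (intro exI[of _ d]) (simp add: d_def)
  qed
  then show ?thesis by (rule that)
qed

text \<open>
  The velocity of a piecewise continuously differentiable path may be unbounded near the exceptional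
  points, so integrability does not follow from continuity of \<open>F\<close>; local primitives supply it.
\<close>

lemma operator_integrable_along:
  fixes F :: "complex \<Rightarrow> 'h::complex_hilbert \<Rightarrow>\<^sub>L 'h"
  assumes "open D" and cont: "continuous_on D F"
    and hol: "\<And>x y. (\<lambda>z. coef x y (F z)) holomorphic_on D"
    and g: "valid_path g" "path_image g \<subseteq> D"
  shows "(\<lambda>t. scale_op (vector_derivative g (at t within {0..1})) (F (g t))) integrable_on {0..1}"
proof -
  let ?f = "\<lambda>t. scale_op (vector_derivative g (at t within {0..1})) (F (g t))"
  obtain K where K: "finite K" "g C1_differentiable_on ({0..1} - K)" and contg: "continuous_on {0..1} g"
    using g(1) unfolding valid_path_def piecewise_C1_differentiable_on_def by blast
  obtain g' where g': "\<And>t. t \<in> {0..1} - K \<Longrightarrow> (g has_vector_derivative g' t) (at t)"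
    using K(2) unfolding C1_differentiable_on_def by blast
  have "?f integrable_on cbox 0 1"
  proof (rule integrable_on_little_subintervals, intro ballI)
    fix t :: real assume t: "t \<in> cbox 0 1"
    then have "g t \<in> D" using g(2) by (auto simp: path_image_def)
    then obtain e where e: "e > 0" "ball (g t) e \<subseteq> D"
      using assms(1) openE by blast
    obtain P where P: "\<And>z. z \<in> ball (g t) e \<Longrightarrow> (P has_derivative (\<lambda>h. scale_op h (F z))) (at z)"
      using operator_primitive[OF convex_ball open_ball continuous_on_subset[OF cont e(2)]
          holomorphic_on_subset[OF hol e(2)]] by blast
    obtain d where d: "d > 0" "\<And>s. s \<in> {0..1} \<Longrightarrow> dist s t < d \<Longrightarrow> dist (g s) (g t) < e"
      using contg t e(1) unfolding continuous_on_iff by (metis cbox_interval)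
    have "?f integrable_on cbox u v"
      if uv: "t \<in> cbox u v" "cbox u v \<subseteq> ball t d" "cbox u v \<subseteq> cbox 0 1" for u v
    proof -
      have near: "g s \<in> ball (g t) e" if "s \<in> {u..v}" for s
        using d(2)[of s] that uv(2,3) by (auto simp: dist_commute subset_iff)
      have "(?f has_integral (P \<circ> g) v - (P \<circ> g) u) {u..v}"
      proof (rule fundamental_theorem_of_calculus_interior_strong[OF K(1)])
        show "u \<le> v" using uv(1) by auto
        have "continuous_on (ball (g t) e) P"
          using P by (meson continuous_at_imp_continuous_on has_derivative_continuous)
        moreover have "continuous_on {u..v} g"
          using contg uv(3) by (auto intro: continuous_on_subset)
        ultimately show "continuous_on {u..v} (P \<circ> g)"
          using near by (intro continuous_on_compose) (auto intro: continuous_on_subset)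
        fix s assume s: "s \<in> {u<..<v} - K"
        then have s01: "s \<in> {0..1} - K" "s \<in> {0<..<1}"
          using uv(3) by auto
        have "((P \<circ> g) has_derivative (\<lambda>h. scale_op h (F (g s))) \<circ> (\<lambda>h. h *\<^sub>R g' s)) (at s)"
          using g'[OF s01(1)] P[OF near] s
          by (intro diff_chain_at) (auto simp: has_vector_derivative_def)
        moreover have "vector_derivative g (at s within {0..1}) = g' s"
          using g'[OF s01(1)] s01(2) by (intro vector_derivative_at_within_ivl) auto
        ultimately show "((P \<circ> g) has_vector_derivative ?f s) (at s)"
          by (simp add: has_vector_derivative_def comp_def
              bounded_bilinear.scaleR_left[OF bounded_bilinear_scale_op])
      qed
      then show ?thesis by (auto simp: integrable_on_def)
    qed
    then show "\<exists>d>0. \<forall>u v. t \<in> cbox u v \<and> cbox u v \<subseteq> ball t d \<and> cbox u v \<subseteq> cbox 0 1 \<longrightarrow>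
        ?f integrable_on cbox u v"
      using d(1) by blast
  qed
  then show ?thesis by simp
qed

lemma coef_op_contour_integral:
  assumes "(\<lambda>t. scale_op (vector_derivative g (at t within {0..1})) (F (g t))) integrable_on {0..1}"
  shows "((\<lambda>z. coef x y (F z)) has_contour_integral coef x y (op_contour_integral g F)) g"
  using has_integral_linear[OF integrable_integral[OF assms] bounded_linear_coef[of x y]]
  by (simp add: op_contour_integral_def has_contour_integral_def comp_def coef_scale_op mult.commute)

section \<open>Separation of a point from a closed subspace\<close>

definition sublinear :: "('a::real_vector \<Rightarrow> real) \<Rightarrow> bool" where
  "sublinear q \<longleftrightarrow> (\<forall>x y. q (x + y) \<le> q x + q y) \<and> (\<forall>t\<ge>0. \<forall>x. q (t *\<^sub>R x) \<le> t * q x)"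

lemma sublinearD:
  assumes "sublinear q"
  shows "q (x + y) \<le> q x + q y" "0 \<le> t \<Longrightarrow> q (t *\<^sub>R x) = t * q x" "- q (- x) \<le> q x" "q 0 = 0"
proof -
  show add: "q (x + y) \<le> q x + q y" for x y
    using assms by (simp add: sublinear_def)
  have le: "q (t *\<^sub>R x) \<le> t * q x" if "0 \<le> t" for t x
    using assms that by (simp add: sublinear_def)
  show zero: "q 0 = 0"
    using le[of 0 0] add[of 0 0] by simp
  show "q (t *\<^sub>R x) = t * q x" if "0 \<le> t"
  proof (cases "t = 0")
    case False
    have "q x \<le> (1 / t) * q (t *\<^sub>R x)"
      using le[of "1 / t" "t *\<^sub>R x"] that False by simp
    then show ?thesis
      using le[of t x] that False by (simp add: field_simps)
  qed (simp add: zero)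
  show "- q (- x) \<le> q x"
    using add[of x "- x"] zero by simp
qed

text \<open>
  The reduced functional is the infimum of \<open>q (x + t y) - t q y\<close> over \<open>t \<ge> 0\<close>; it stays finite since
  the triangle inequality bounds the terms below by \<open>- q (- x)\<close>. The terms with \<open>t = 1\<close>
  give the last two inequalities.
\<close>

lemma sublinear_reduction:
  assumes q: "sublinear q"
  obtains r where "sublinear r" "\<And>x. r x \<le> q x" "\<And>x. r x \<le> q (x + y) - q y" "r (- y) \<le> - q y"
proof -
  define r where "r x = (INF t\<in>{0..}. q (x + t *\<^sub>R y) - t * q y)" for x
  have lower: "- q (- x) \<le> q (x + t *\<^sub>R y) - t * q y" if "0 \<le> t" for x t
    using sublinearD(1)[OF q, of "x + t *\<^sub>R y" "- x"] sublinearD(2)[OF q that, of y] by simp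
  have r_le: "r x \<le> q (x + t *\<^sub>R y) - t * q y" if "0 \<le> t" for x t
    unfolding r_def by (rule cINF_lower) (use that lower in \<open>auto intro!: bdd_belowI2\<close>)
  have le_r: "c \<le> r x" if "\<And>t. 0 \<le> t \<Longrightarrow> c \<le> q (x + t *\<^sub>R y) - t * q y" for c x
    unfolding r_def by (rule cINF_greatest) (use that in auto)
  have "r (u + v) \<le> r u + r v" for u v
  proof -
    have "r (u + v) - (q (v + s *\<^sub>R y) - s * q y) \<le> r u" if s: "0 \<le> s" for s
    proof (rule le_r)
      fix t :: real assume t: "0 \<le> t"
      have "r (u + v) \<le> q ((u + t *\<^sub>R y) + (v + s *\<^sub>R y)) - (t + s) * q y"
        using r_le[of "t + s" "u + v"] s t by (simp add: algebra_simps)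
      also have "\<dots> \<le> q (u + t *\<^sub>R y) + q (v + s *\<^sub>R y) - (t + s) * q y"
        using sublinearD(1)[OF q] by simp
      finally show "r (u + v) - (q (v + s *\<^sub>R y) - s * q y) \<le> q (u + t *\<^sub>R y) - t * q y"
        by (simp add: algebra_simps)
    qed
    then have "r (u + v) - r u \<le> q (v + s *\<^sub>R y) - s * q y" if "0 \<le> s" for s
      using that by (smt (verit))
    from le_r[OF this] show ?thesis by simp
  qed
  moreover have "r (s *\<^sub>R u) \<le> s * r u" if s: "0 \<le> s" for s u
  proof (cases "s = 0")
    case True
    then show ?thesis using r_le[of 0 0] sublinearD(4)[OF q] by simp
  next
    case False
    have "r (s *\<^sub>R u) / s \<le> r u"
    proof (rule le_r)
      fix t :: real assume t: "0 \<le> t"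
      have "r (s *\<^sub>R u) \<le> q (s *\<^sub>R (u + t *\<^sub>R y)) - s * t * q y"
        using r_le[of "s * t" "s *\<^sub>R u"] s t by (simp add: algebra_simps)
      also have "\<dots> = s * (q (u + t *\<^sub>R y) - t * q y)"
        by (simp only: sublinearD(2)[OF q s]) (simp add: algebra_simps)
      finally show "r (s *\<^sub>R u) / s \<le> q (u + t *\<^sub>R y) - t * q y"
        using s False by (simp add: field_simps)
    qed
    then show ?thesis using s False by (simp add: field_simps)
  qed
  ultimately have "sublinear r" by (simp add: sublinear_def)
  moreover have "r x \<le> q x" for x
    using r_le[of 0 x] by simp
  moreover have "r x \<le> q (x + y) - q y" for x
    using r_le[of 1 x] by simp
  moreover have "r (- y) \<le> - q y"
    using r_le[of 1 "- y"] sublinearD(4)[OF q] by simp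
  ultimately show thesis by (rule that)
qed

text \<open>
  A minimal sublinear functional is linear, because otherwise it could be reduced in the direction
  of some vector.
\<close>

lemma linear_below_sublinear:
  fixes q0 :: "'a::real_vector \<Rightarrow> real"
  assumes q0: "sublinear q0"
  shows "\<exists>f. linear f \<and> (\<forall>x. f x \<le> q0 x)"
proof -
  define A where "A = {q. sublinear q \<and> (\<forall>x. q x \<le> q0 x)}"
  define P where "P q r \<longleftrightarrow> (\<forall>x. r x \<le> q x)" for q r :: "'a \<Rightarrow> real"
  have "\<exists>m\<in>A. \<forall>a\<in>A. P m a \<longrightarrow> a = m"
  proof (rule predicate_Zorn)
    show "partial_order_on A (relation_of P A)"
    proof (rule partial_order_on_relation_ofI)
      show "P a c" if "P a b" "P b c" for a b c
        using that unfolding P_def by (meson order_trans)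
      show "a = b" if "P a b" "P b a" for a b
        using that by (auto simp: P_def intro: antisym)
    qed (simp add: P_def)
    fix C assume C: "C \<in> Chains (relation_of P A)"
    then have CA: "q \<in> A" if "q \<in> C" for q
      using that by (auto simp: Chains_def relation_of_def)
    have tot: "P q r \<or> P r q" if "q \<in> C" "r \<in> C" for q r
      using C that by (auto simp: Chains_def relation_of_def)
    show "\<exists>u\<in>A. \<forall>a\<in>C. P a u"
    proof (cases "C = {}")
      case True
      then show ?thesis using q0 by (auto simp: A_def)
    next
      case False
      define u where "u x = (INF q\<in>C. q x)" for x
      have bdd: "bdd_below ((\<lambda>q. q x) ` C)" for x
      proof (rule bdd_belowI2)
        fix q assume "q \<in> C"
        then have "sublinear q" "q (- x) \<le> q0 (- x)" using CA by (auto simp: A_def)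
        then show "- q0 (- x) \<le> q x" using sublinearD(3)[of q x] by linarith
      qed
      have u_le: "u x \<le> q x" if "q \<in> C" for q x
        unfolding u_def by (rule cINF_lower[OF bdd that])
      have le_u: "c \<le> u x" if "\<And>q. q \<in> C \<Longrightarrow> c \<le> q x" for c x
        unfolding u_def by (rule cINF_greatest[OF False that])
      have sub: "sublinear q" if "q \<in> C" for q
        using CA that by (simp add: A_def)
      have "u (x + y) \<le> u x + u y" for x y
      proof -
        have pair: "u (x + y) \<le> q x + r y" if "q \<in> C" "r \<in> C" for q r
        proof -
          obtain s where s: "s \<in> C" "s x \<le> q x" "s y \<le> r y"
            using tot[OF \<open>q \<in> C\<close> \<open>r \<in> C\<close>] \<open>q \<in> C\<close> \<open>r \<in> C\<close> by (auto simp: P_def)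
          have "u (x + y) \<le> s (x + y)" by (rule u_le[OF s(1)])
          also have "\<dots> \<le> s x + s y" by (rule sublinearD(1)[OF sub[OF s(1)]])
          finally show ?thesis using s by simp
        qed
        have "u (x + y) - r y \<le> u x" if "r \<in> C" for r
          by (rule le_u) (use pair that in \<open>simp add: algebra_simps\<close>)
        then have "u (x + y) - u x \<le> u y"
          by (intro le_u) (simp add: algebra_simps)
        then show ?thesis by simp
      qed
      moreover have "u (t *\<^sub>R x) \<le> t * u x" if t: "0 \<le> t" for t x
      proof -
        have *: "u (t *\<^sub>R x) \<le> t * q x" if "q \<in> C" for q
          using u_le[OF that, of "t *\<^sub>R x"] sublinearD(2)[OF sub[OF that] t] by simp
        show ?thesis
        proof (cases "t = 0")
          case True
          then show ?thesis using * False by auto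
        next
          case False
          then have "u (t *\<^sub>R x) / t \<le> u x"
            by (intro le_u) (use * t in \<open>simp add: field_simps\<close>)
          then show ?thesis using False t by (simp add: field_simps)
        qed
      qed
      moreover have "u x \<le> q0 x" for x
      proof -
        obtain q where "q \<in> C" using False by blast
        then show ?thesis using u_le[of q x] CA[of q] by (auto simp: A_def intro: order_trans)
      qed
      ultimately have "u \<in> A" by (simp add: A_def sublinear_def)
      then show ?thesis using u_le by (auto simp: P_def)
    qed
  qed
  then obtain m where "m \<in> A" and min: "\<And>a. a \<in> A \<Longrightarrow> P m a \<Longrightarrow> a = m" by blast
  then have m: "sublinear m" "\<And>x. m x \<le> q0 x" by (auto simp: A_def)
  have add: "m (x + y) = m x + m y" for x y
  proof -
    obtain r where r: "sublinear r" "\<And>x. r x \<le> m x" "\<And>x. r x \<le> m (x + y) - m y"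
      using sublinear_reduction[OF m(1), of y] by metis
    have "r \<in> A" using r(1,2) m(2) by (auto simp: A_def intro: order_trans)
    then have "r = m" using min r(2) by (simp add: P_def)
    then show ?thesis using r(3)[of x] sublinearD(1)[OF m(1), of x y] by simp
  qed
  have neg: "m (- x) = - m x" for x
    using add[of x "- x"] sublinearD(4)[OF m(1)] by simp
  have scale: "m (t *\<^sub>R x) = t * m x" for t x
  proof (cases "0 \<le> t")
    case False
    have "m (t *\<^sub>R x) = - m ((- t) *\<^sub>R x)" by (simp add: neg)
    then show ?thesis using False sublinearD(2)[OF m(1), of "- t" x] by simp
  qed (simp add: sublinearD(2)[OF m(1)])
  have "linear m"
    by (rule linearI) (simp_all add: add scale)
  then show ?thesis using m(2) by blast
qed

text \<open>
  The seminorm given by the distance to \<open>V\<close> is reduced in the direction of \<open>x\<close> before a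
  linear functional is chosen below it; this forces the functional to be at least the distance
  of \<open>x\<close> from \<open>V\<close> at \<open>x\<close>.
\<close>

lemma separating_functional:
  fixes V :: "'a::real_normed_vector set"
  assumes V: "closed V" "subspace V" and x: "x \<notin> V"
  obtains f where "bounded_linear f" "\<And>v. v \<in> V \<Longrightarrow> f v = (0::real)" "f x \<noteq> 0"
proof -
  have ne: "V \<noteq> {}" using V(2) subspace_0 by blast
  let ?q = "\<lambda>x. infdist x V"
  have le: "c \<le> ?q u" if "\<And>v. v \<in> V \<Longrightarrow> c \<le> dist u v" for c u
    unfolding infdist_notempty[OF ne] by (rule cINF_greatest[OF ne that])
  have "?q (u + v) \<le> ?q u + ?q v" for u v
  proof -
    have "?q (u + v) \<le> dist u a + dist v b" if "a \<in> V" "b \<in> V" for a b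
      using infdist_le[OF subspace_add[OF V(2) that], of "u + v"] dist_triangle_add[of u v a b]
      by linarith
    then have "?q (u + v) - dist u a \<le> ?q v" if "a \<in> V" for a
      using that by (intro le) (simp add: algebra_simps)
    then have "?q (u + v) - ?q v \<le> ?q u"
      by (intro le) (simp add: algebra_simps)
    then show ?thesis by simp
  qed
  moreover have "?q (t *\<^sub>R u) \<le> t * ?q u" if t: "0 \<le> t" for t u
  proof (cases "t = 0")
    case True
    then show ?thesis using subspace_0[OF V(2)] by simp
  next
    case False
    have "?q (t *\<^sub>R u) / t \<le> ?q u"
    proof (rule le)
      fix v assume "v \<in> V"
      then have "?q (t *\<^sub>R u) \<le> dist (t *\<^sub>R u) (t *\<^sub>R v)"
        by (intro infdist_le subspace_scale[OF V(2)])
      also have "\<dots> = norm (t *\<^sub>R (u - v))"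
        by (simp only: dist_norm scaleR_diff_right)
      also have "\<dots> = t * dist u v"
        using t by (simp add: dist_norm)
      finally have "?q (t *\<^sub>R u) \<le> t * dist u v" .
      then show "?q (t *\<^sub>R u) / t \<le> dist u v"
        using t False by (simp add: field_simps)
    qed
    then show ?thesis using t False by (simp add: field_simps)
  qed
  ultimately have "sublinear ?q" by (simp add: sublinear_def)
  then obtain r where r: "sublinear r" "\<And>u. r u \<le> ?q u" "r (- x) \<le> - ?q x"
    using sublinear_reduction[of ?q x] by metis
  obtain f where f: "linear f" "\<And>u. f u \<le> r u"
    using linear_below_sublinear[OF r(1)] by blast
  have f_le: "f u \<le> norm u" for u
    using f(2)[of u] r(2)[of u] infdist_le[OF subspace_0[OF V(2)], of u] by simp
  show thesis
  proof
    show "bounded_linear f"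
    proof (rule bounded_linear_intro[where K = 1])
      show "norm (f u) \<le> norm u * 1" for u
        using f_le[of u] f_le[of "- u"] by (simp add: linear_neg[OF f(1)])
    qed (simp_all add: linear_add[OF f(1)] linear_scale[OF f(1)])
    show "f v = 0" if v: "v \<in> V" for v
    proof -
      have "f v \<le> 0" "f (- v) \<le> 0"
        using f(2) r(2) v subspace_neg[OF V(2) v] by (metis infdist_zero order_trans)+
      then show ?thesis by (simp add: linear_neg[OF f(1)])
    qed
    have "?q x > 0"
      using V(1) x ne by (metis in_closed_iff_infdist_zero infdist_nonneg less_eq_real_def)
    moreover have "f (- x) \<le> - ?q x"
      using f(2)[of "- x"] r(3) by simp
    ultimately show "f x \<noteq> 0" by (simp add: linear_neg[OF f(1)])
  qed
qed

section \<open>Integrals of the resolvent over circles\<close>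

definition circle_int ::
    "complex \<Rightarrow> real \<Rightarrow> (complex \<Rightarrow> 'h::complex_hilbert \<Rightarrow>\<^sub>L 'h) \<Rightarrow> ('h \<Rightarrow>\<^sub>L 'h)" where
  "circle_int \<mu> \<rho> F = scale_op (1 / (2 * of_real pi * \<i>)) (op_contour_integral (circlepath \<mu> \<rho>) F)"

lemma circlepath_in_sphere: "0 < \<rho> \<Longrightarrow> t \<in> {0..1} \<Longrightarrow> circlepath \<mu> \<rho> t \<in> sphere \<mu> \<rho>"
  using path_image_circlepath_nonneg[of \<rho> \<mu>] by (auto simp: path_image_def)

lemma circle_integrable:
  assumes "0 < \<rho>" and F: "continuous_on (sphere \<mu> \<rho>) F"
  shows "(\<lambda>t. scale_op (vector_derivative (circlepath \<mu> \<rho>) (at t within {0..1}))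
    (F (circlepath \<mu> \<rho> t))) integrable_on {0..1}"
proof (rule integrable_eq)
  show "(\<lambda>t. scale_op (2 * pi * \<i> * \<rho> * exp (2 * of_real pi * \<i> * t)) (F (circlepath \<mu> \<rho> t)))
      integrable_on {0..1}"
  proof (intro integrable_continuous_real
      bounded_bilinear.continuous_on[OF bounded_bilinear_scale_op])
    show "continuous_on {0..1} (\<lambda>t. F (circlepath \<mu> \<rho> t))"
      using path_circlepath[of \<mu> \<rho>] circlepath_in_sphere[OF assms(1)]
      by (intro continuous_on_compose2[OF F]) (auto simp: path_def)
  qed (intro continuous_intros)
qed (simp add: vector_derivative_circlepath01)

lemma coef_circle_int:
  assumes "0 < \<rho>" "continuous_on (sphere \<mu> \<rho>) F"
  shows "((\<lambda>z. coef x y (F z)) has_contour_integral 2 * of_real pi * \<i> * coef x y (circle_int \<mu> \<rho> F))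
    (circlepath \<mu> \<rho>)"
  using coef_op_contour_integral[OF circle_integrable[OF assms]]
  by (simp add: circle_int_def coef_scale_op)

lemma circle_int_cong:
  assumes "0 < \<rho>" "\<And>z. z \<in> sphere \<mu> \<rho> \<Longrightarrow> F z = G z"
  shows "circle_int \<mu> \<rho> F = circle_int \<mu> \<rho> G"
  unfolding circle_int_def op_contour_integral_def
  using assms circlepath_in_sphere by (intro arg_cong[of _ _ "scale_op _"] integral_cong) auto

lemma circle_int_add:
  assumes "0 < \<rho>" and F: "continuous_on (sphere \<mu> \<rho>) F" and G: "continuous_on (sphere \<mu> \<rho>) G"
  shows "circle_int \<mu> \<rho> (\<lambda>z. F z + G z) = circle_int \<mu> \<rho> F + circle_int \<mu> \<rho> G"
  unfolding circle_int_def op_contour_integral_def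
  using integral_add[OF circle_integrable[OF assms(1) F] circle_integrable[OF assms(1) G]]
  by (simp add: scale_op_simps)

lemma compose_circle_int:
  assumes "0 < \<rho>" and F: "continuous_on (sphere \<mu> \<rho>) F" and a: "a \<in> bounded_ops"
  shows "a o\<^sub>L circle_int \<mu> \<rho> F = circle_int \<mu> \<rho> (\<lambda>z. a o\<^sub>L F z)"
  unfolding circle_int_def op_contour_integral_def
  using integral_linear[OF circle_integrable[OF assms(1) F]
      bounded_bilinear.bounded_linear_right[OF bounded_bilinear_blinfun_compose, of a]]
  by (simp add: compose_scale_op[OF a] comp_def)

lemma circle_int_scalar:
  assumes "0 < \<rho>" and h: "continuous_on (sphere \<mu> \<rho>) h"
  shows "circle_int \<mu> \<rho> (\<lambda>z. scale_op (h z) id_blinfun)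
    = scale_op (contour_integral (circlepath \<mu> \<rho>) h / (2 * of_real pi * \<i>))
        (id_blinfun :: 'h::complex_hilbert \<Rightarrow>\<^sub>L 'h)"
proof (rule eq_if_coef_eq)
  fix x y :: 'h
  have cont: "continuous_on (sphere \<mu> \<rho>) (\<lambda>z. scale_op (h z) id_blinfun :: 'h \<Rightarrow>\<^sub>L 'h)"
    by (intro bounded_bilinear.continuous_on[OF bounded_bilinear_scale_op] h continuous_on_const)
  have "h contour_integrable_on circlepath \<mu> \<rho>"
    using h assms(1) by (intro contour_integrable_continuous_circlepath) simp
  then have "((\<lambda>z. h z * coef x y id_blinfun) has_contour_integral
      contour_integral (circlepath \<mu> \<rho>) h * coef x y id_blinfun) (circlepath \<mu> \<rho>)"
    by (intro has_contour_integral_rmul has_contour_integral_integral)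
  moreover have "((\<lambda>z. h z * coef x y id_blinfun) has_contour_integral
      2 * of_real pi * \<i> * coef x y (circle_int \<mu> \<rho> (\<lambda>z. scale_op (h z) id_blinfun))) (circlepath \<mu> \<rho>)"
    using coef_circle_int[OF assms(1) cont, of x y] by (simp add: coef_scale_op)
  ultimately show "coef x y (circle_int \<mu> \<rho> (\<lambda>z. scale_op (h z) id_blinfun)) =
      coef x y (scale_op (contour_integral (circlepath \<mu> \<rho>) h / (2 * of_real pi * \<i>)) id_blinfun)"
    using has_contour_integral_unique by (fastforce simp: coef_scale_op field_simps)
qed

lemma norm_circle_int_le:
  assumes "0 < \<rho>" and F: "continuous_on (sphere \<mu> \<rho>) F"
    and B: "0 \<le> B" "\<And>z. z \<in> sphere \<mu> \<rho> \<Longrightarrow> norm (F z) \<le> B"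
  shows "norm (circle_int \<mu> \<rho> F) \<le> B * \<rho>"
proof (rule norm_le_if_coef_le)
  fix x y
  have "norm (2 * of_real pi * \<i> * coef x y (circle_int \<mu> \<rho> F)) \<le> (B * (norm x * norm y)) * (2 * pi * \<rho>)"
  proof (rule has_contour_integral_bound_circlepath[OF coef_circle_int[OF assms(1) F]])
    fix z assume "cmod (z - \<mu>) = \<rho>"
    then have "norm (F z) \<le> B" by (intro B) (simp add: dist_norm norm_minus_commute)
    then show "cmod (coef x y (F z)) \<le> B * (norm x * norm y)"
      using norm_coef_le[of x y "F z"] by (meson mult_right_mono order_trans mult_nonneg_nonneg norm_ge_zero)
  qed (use assms in auto)
  then show "cmod (coef x y (circle_int \<mu> \<rho> F)) \<le> B * \<rho> * (norm x * norm y)"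
    by (simp add: norm_mult field_simps)
qed (use assms in simp)

text \<open>
  A real functional that vanishes on \<open>A\<close> annihilates the integrand, hence the integral.
\<close>

lemma circle_int_in:
  assumes A: "closed_subalgebra A" and "0 < \<rho>" and F: "continuous_on (sphere \<mu> \<rho>) F"
    and "\<And>z. z \<in> sphere \<mu> \<rho> \<Longrightarrow> F z \<in> A"
  shows "circle_int \<mu> \<rho> F \<in> A"
proof -
  have "op_contour_integral (circlepath \<mu> \<rho>) F \<in> A"
  proof (rule ccontr)
    assume "op_contour_integral (circlepath \<mu> \<rho>) F \<notin> A"
    then obtain f where f: "bounded_linear f" "\<And>v. v \<in> A \<Longrightarrow> f v = (0::real)"
        "f (op_contour_integral (circlepath \<mu> \<rho>) F) \<noteq> 0"
      using separating_functional[OF closed_subalgebraD(2)[OF A] closed_subalgebra_subspace[OF A]]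
      by metis
    have "f (op_contour_integral (circlepath \<mu> \<rho>) F) = integral {0..1} (\<lambda>t.
        f (scale_op (vector_derivative (circlepath \<mu> \<rho>) (at t within {0..1})) (F (circlepath \<mu> \<rho> t))))"
      unfolding op_contour_integral_def
      using integral_linear[OF circle_integrable[OF assms(2) F] f(1)] by (simp add: comp_def)
    also have "\<dots> = integral {0..1} (\<lambda>_::real. 0)"
      using closed_subalgebraD(5)[OF A] assms(4) circlepath_in_sphere[OF assms(2)]
      by (intro integral_cong) (simp add: f(2))
    finally show False using f(3) by simp
  qed
  then show ?thesis
    unfolding circle_int_def by (rule closed_subalgebraD(5)[OF A])
qed

context
  fixes T :: "'h::complex_hilbert \<Rightarrow>\<^sub>L 'h" and \<mu> :: complex and \<rho> :: real
  assumes T: "T \<in> bounded_ops" and rho: "0 < \<rho>" and sphere: "sphere \<mu> \<rho> \<inter> Sp T = {}"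
begin

lemma continuous_on_sphere_resolvent:
  "continuous_on (sphere \<mu> \<rho>) h \<Longrightarrow> continuous_on (sphere \<mu> \<rho>) (\<lambda>w. scale_op (h w) (resolvent T w))"
  using sphere
  by (intro bounded_bilinear.continuous_on[OF bounded_bilinear_scale_op]
      continuous_on_subset[OF continuous_on_resolvent]) auto

text \<open>
  The integrated form of \<open>(z - T) R(w) = (z - w) R(w) + id\<close>. The choices \<open>h w = 1 / (w - z)\<close> and
  \<open>h w = (w - \<mu>)^n\<close> below yield inverses and estimates of powers.
\<close>

lemma compose_circle_int_resolvent:
  assumes h: "continuous_on (sphere \<mu> \<rho>) h"
  shows "(scale_op z id_blinfun - T) o\<^sub>L circle_int \<mu> \<rho> (\<lambda>w. scale_op (h w) (resolvent T w))
    = circle_int \<mu> \<rho> (\<lambda>w. scale_op ((z - w) * h w) (resolvent T w))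
      + scale_op (contour_integral (circlepath \<mu> \<rho>) h / (2 * of_real pi * \<i>)) id_blinfun"
proof -
  have b: "scale_op z id_blinfun - T \<in> bounded_ops"
    by (intro closed_subalgebraD(8)[OF closed_subalgebra_bounded_ops] T
        closed_subalgebraD(5)[OF closed_subalgebra_bounded_ops] id_in_bounded_ops)
  have "(scale_op z id_blinfun - T) o\<^sub>L circle_int \<mu> \<rho> (\<lambda>w. scale_op (h w) (resolvent T w))
      = circle_int \<mu> \<rho> (\<lambda>w. (scale_op z id_blinfun - T) o\<^sub>L scale_op (h w) (resolvent T w))"
    by (rule compose_circle_int[OF rho continuous_on_sphere_resolvent[OF h] b])
  also have "\<dots> = circle_int \<mu> \<rho>
      (\<lambda>w. scale_op ((z - w) * h w) (resolvent T w) + scale_op (h w) id_blinfun)"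
  proof (rule circle_int_cong[OF rho])
    fix w assume "w \<in> sphere \<mu> \<rho>"
    then have w: "w \<notin> Sp T" using sphere by blast
    have "(scale_op z id_blinfun - T) o\<^sub>L scale_op (h w) (resolvent T w)
        = scale_op (h w) (scale_op z (resolvent T w) - (T o\<^sub>L resolvent T w))"
      by (subst compose_scale_op[OF b]) (simp add: compose_simps(3) scale_op_compose)
    also have "\<dots> = scale_op ((z - w) * h w) (resolvent T w) + scale_op (h w) id_blinfun"
      by (simp add: compose_resolvent[OF w] scale_op_simps algebra_simps)
    finally show "(scale_op z id_blinfun - T) o\<^sub>L scale_op (h w) (resolvent T w)
        = scale_op ((z - w) * h w) (resolvent T w) + scale_op (h w) id_blinfun" .
  qed
  also have "\<dots> = circle_int \<mu> \<rho> (\<lambda>w. scale_op ((z - w) * h w) (resolvent T w))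
      + circle_int \<mu> \<rho> (\<lambda>w. scale_op (h w) id_blinfun)"
    by (intro circle_int_add[OF rho] continuous_on_sphere_resolvent continuous_intros h
        bounded_bilinear.continuous_on[OF bounded_bilinear_scale_op])
  finally show ?thesis by (simp only: circle_int_scalar[OF rho h])
qed

text \<open>
  With \<open>p\<close> the integral of the resolvent, \<open>z - T\<close> is invertible up to \<open>p\<close> if \<open>z\<close> lies inside
  the circle, and \<open>p\<close> is a multiple of \<open>z - T\<close> if \<open>z\<close> lies outside.
\<close>

lemma circle_int_Cauchy_kernel:
  assumes z: "z \<notin> sphere \<mu> \<rho>"
  defines "K \<equiv> circle_int \<mu> \<rho> (\<lambda>w. scale_op (1 / (w - z)) (resolvent T w))"
  shows "(scale_op z id_blinfun - T) o\<^sub>L K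
    = (if z \<in> ball \<mu> \<rho> then id_blinfun else 0) - circle_int \<mu> \<rho> (resolvent T)"
proof -
  have cont: "continuous_on (sphere \<mu> \<rho>) (\<lambda>w. 1 / (w - z))"
    using z by (intro continuous_intros) auto
  have "contour_integral (circlepath \<mu> \<rho>) (\<lambda>w. 1 / (w - z)) / (2 * of_real pi * \<i>)
      = winding_number (circlepath \<mu> \<rho>) z"
    using z rho by (subst winding_number_valid_path) auto
  also have "\<dots> = (if z \<in> ball \<mu> \<rho> then 1 else 0)"
  proof (cases "z \<in> ball \<mu> \<rho>")
    case True
    then show ?thesis by (simp add: winding_number_circlepath dist_norm norm_minus_commute)
  next
    case False
    then have "winding_number (circlepath \<mu> \<rho>) z = 0"
      using z rho by (intro winding_number_zero_outside[OF _ convex_cball[of \<mu> \<rho>]]) auto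
    then show ?thesis using False by simp
  qed
  finally have wind: "contour_integral (circlepath \<mu> \<rho>) (\<lambda>w. 1 / (w - z)) / (2 * of_real pi * \<i>)
      = (if z \<in> ball \<mu> \<rho> then 1 else 0)" .
  have "circle_int \<mu> \<rho> (\<lambda>w. scale_op ((z - w) * (1 / (w - z))) (resolvent T w))
      = circle_int \<mu> \<rho> (\<lambda>w. - id_blinfun o\<^sub>L resolvent T w)"
  proof (rule circle_int_cong[OF rho])
    fix w assume "w \<in> sphere \<mu> \<rho>"
    then have "w \<noteq> z" using z by auto
    then have "(z - w) * (1 / (w - z)) = - 1"
      by (simp add: divide_simps)
    then show "scale_op ((z - w) * (1 / (w - z))) (resolvent T w) = - id_blinfun o\<^sub>L resolvent T w"
      by (simp only: scale_op_minus_one) (simp add: compose_simps)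
  qed
  also have "\<dots> = - id_blinfun o\<^sub>L circle_int \<mu> \<rho> (resolvent T)"
    using continuous_on_sphere_resolvent[of "\<lambda>_. 1"] id_in_bounded_ops
      closed_subalgebraD(7)[OF closed_subalgebra_bounded_ops]
    by (intro compose_circle_int[symmetric] rho) auto
  also have "\<dots> = - circle_int \<mu> \<rho> (resolvent T)"
    by (simp add: compose_simps)
  finally show ?thesis
    unfolding K_def compose_circle_int_resolvent[OF cont] wind by simp
qed

lemma op_power_compose_circle_int:
  "op_power (T - scale_op \<mu> id_blinfun) n o\<^sub>L circle_int \<mu> \<rho> (resolvent T)
    = circle_int \<mu> \<rho> (\<lambda>w. scale_op ((w - \<mu>) ^ n) (resolvent T w))"
proof (induction n)
  case (Suc n)
  let ?J = "\<lambda>n. circle_int \<mu> \<rho> (\<lambda>w. scale_op ((w - \<mu>) ^ n) (resolvent T w))"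
  have cont: "continuous_on (sphere \<mu> \<rho>) (\<lambda>w. - ((w - \<mu>) ^ n))"
    by (intro continuous_intros)
  have "((\<lambda>w. - ((w - \<mu>) ^ n)) has_contour_integral 0) (circlepath \<mu> \<rho>)"
    using rho by (intro Cauchy_theorem_convex_simple[OF _ convex_UNIV] holomorphic_intros) auto
  then have zero: "contour_integral (circlepath \<mu> \<rho>) (\<lambda>w. - ((w - \<mu>) ^ n)) = 0"
    by (rule contour_integral_unique)
  have neg: "- (scale_op \<mu> id_blinfun - T) = T - scale_op \<mu> id_blinfun" by simp
  have neg_J: "circle_int \<mu> \<rho> (\<lambda>w. scale_op (- ((w - \<mu>) ^ n)) (resolvent T w)) = - ?J n"
  proof -
    have "circle_int \<mu> \<rho> (\<lambda>w. scale_op (- ((w - \<mu>) ^ n)) (resolvent T w))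
        = circle_int \<mu> \<rho> (\<lambda>w. - id_blinfun o\<^sub>L scale_op ((w - \<mu>) ^ n) (resolvent T w))"
      by (simp add: compose_simps scale_op_simps)
    also have "\<dots> = - id_blinfun o\<^sub>L ?J n"
      using id_in_bounded_ops closed_subalgebraD(7)[OF closed_subalgebra_bounded_ops]
      by (intro compose_circle_int[symmetric] rho continuous_on_sphere_resolvent continuous_intros)
        auto
    finally show ?thesis by (simp add: compose_simps)
  qed
  have "op_power (T - scale_op \<mu> id_blinfun) (Suc n) o\<^sub>L circle_int \<mu> \<rho> (resolvent T)
      = - (scale_op \<mu> id_blinfun - T) o\<^sub>L ?J n"
    by (simp only: op_power.simps compose_assoc Suc.IH neg)
  also have "\<dots> = (scale_op \<mu> id_blinfun - T) o\<^sub>L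
      circle_int \<mu> \<rho> (\<lambda>w. scale_op (- ((w - \<mu>) ^ n)) (resolvent T w))"
    unfolding neg_J by (simp only: compose_simps(5,6))
  also have "\<dots> = circle_int \<mu> \<rho> (\<lambda>w. scale_op ((\<mu> - w) * (- ((w - \<mu>) ^ n))) (resolvent T w))"
    unfolding compose_circle_int_resolvent[OF cont] zero by simp
  also have "\<dots> = ?J (Suc n)"
    by (simp add: algebra_simps)
  finally show ?case .
qed simp

lemma norm_op_power_compose_circle_int:
  "\<exists>C\<ge>0. \<forall>n. norm (op_power (T - scale_op \<mu> id_blinfun) n o\<^sub>L circle_int \<mu> \<rho> (resolvent T)) \<le> C * \<rho> ^ n"
proof -
  have cont: "continuous_on (sphere \<mu> \<rho>) (resolvent T)"
    using continuous_on_sphere_resolvent[of "\<lambda>_. 1"] by simp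
  then have "bounded (resolvent T ` sphere \<mu> \<rho>)"
    by (intro compact_imp_bounded compact_continuous_image) auto
  then obtain B where B: "B > 0" "\<And>w. w \<in> sphere \<mu> \<rho> \<Longrightarrow> norm (resolvent T w) \<le> B"
    by (auto simp: bounded_pos)
  have "norm (circle_int \<mu> \<rho> (\<lambda>w. scale_op ((w - \<mu>) ^ n) (resolvent T w))) \<le> (\<rho> ^ n * B) * \<rho>" for n
  proof (rule norm_circle_int_le[OF rho])
    show "norm (scale_op ((w - \<mu>) ^ n) (resolvent T w)) \<le> \<rho> ^ n * B" if "w \<in> sphere \<mu> \<rho>" for w
      using B(2)[OF that] that rho
      by (simp add: norm_scale_op norm_power dist_norm norm_minus_commute)
  qed (use B rho in \<open>auto intro!: continuous_on_sphere_resolvent continuous_intros\<close>)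
  then show ?thesis
    unfolding op_power_compose_circle_int using B rho
    by (intro exI[of _ "B * \<rho>"]) (simp add: mult_ac)
qed

end

text \<open>
  The integral of the resolvent over a circle is independent of the radius by homotopy, and tends to
  the identity as the radius grows.
\<close>

lemma circle_int_resolvent_eq_id:
  assumes S: "S \<in> bounded_ops" and eps: "0 < \<epsilon>" and out: "Sp S \<subseteq> ball 0 \<epsilon>"
  shows "circle_int 0 \<epsilon> (resolvent S) = id_blinfun"
proof -
  let ?J = "\<lambda>\<rho>. circle_int 0 \<rho> (resolvent S)"
  have cont: "continuous_on (sphere 0 \<rho>) (resolvent S)" if "\<epsilon> \<le> \<rho>" for \<rho>
    using that out by (intro continuous_on_subset[OF continuous_on_resolvent]) auto
  have same: "?J \<rho> = ?J \<epsilon>" if "\<epsilon> \<le> \<rho>" for \<rho>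
  proof (rule eq_if_coef_eq)
    fix x y
    have "homotopic_loops (- Sp S) (circlepath 0 \<rho>) (circlepath 0 \<epsilon>)"
    proof (rule homotopic_loops_linear)
      fix t :: real assume "t \<in> {0..1}"
      show "closed_segment (circlepath 0 \<rho> t) (circlepath 0 \<epsilon> t) \<subseteq> - Sp S"
      proof
        fix w assume "w \<in> closed_segment (circlepath 0 \<rho> t) (circlepath 0 \<epsilon> t)"
        then obtain u where u: "0 \<le> u" "u \<le> 1"
            "w = (1 - u) *\<^sub>R circlepath 0 \<rho> t + u *\<^sub>R circlepath 0 \<epsilon> t"
          by (auto simp: in_segment)
        have "w = of_real ((1 - u) * \<rho> + u * \<epsilon>) * exp (2 * of_real pi * \<i> * of_real t)"
          by (simp add: u circlepath scaleR_conv_of_real algebra_simps)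
        then have "cmod w = \<bar>(1 - u) * \<rho> + u * \<epsilon>\<bar>"
          by (simp add: norm_mult del: of_real_add of_real_mult of_real_diff)
        moreover have "(1 - u) * \<epsilon> + u * \<epsilon> \<le> (1 - u) * \<rho> + u * \<epsilon>"
          using u that by (intro add_mono mult_left_mono) auto
        ultimately have "\<epsilon> \<le> cmod w" by (simp add: algebra_simps)
        then show "w \<in> - Sp S" using out by auto
      qed
    qed auto
    then have "contour_integral (circlepath 0 \<rho>) (\<lambda>z. coef x y (resolvent S z))
        = contour_integral (circlepath 0 \<epsilon>) (\<lambda>z. coef x y (resolvent S z))"
      by (rule Cauchy_theorem_homotopic_loops)
        (auto intro: open_resolvent_set coef_resolvent_holomorphic)
    moreover have "contour_integral (circlepath 0 \<sigma>) (\<lambda>z. coef x y (resolvent S z))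
        = 2 * of_real pi * \<i> * coef x y (?J \<sigma>)" if "\<epsilon> \<le> \<sigma>" for \<sigma>
      using coef_circle_int[OF _ cont[OF that]] that eps by (intro contour_integral_unique) auto
    ultimately show "coef x y (?J \<rho>) = coef x y (?J \<epsilon>)"
      using that by simp
  qed
  \<comment> \<open>the Cauchy kernel at 0 writes the difference as \<open>- S K\<close> with \<open>K\<close> small for large \<open>\<rho>\<close>\<close>
  have bound: "norm (id_blinfun - ?J \<epsilon>) \<le> norm S * (1 / (\<rho> - norm S))"
    if rho: "\<epsilon> \<le> \<rho>" "norm S < \<rho>" for \<rho>
  proof -
    have pos: "0 < \<rho>" using eps rho by simp
    have sph: "sphere 0 \<rho> \<inter> Sp S = {}" using rho out by auto
    define K where "K = circle_int 0 \<rho> (\<lambda>w. scale_op (1 / w) (resolvent S w))"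
    have "norm K \<le> (1 / \<rho> * (1 / (\<rho> - norm S))) * \<rho>"
      unfolding K_def
    proof (rule norm_circle_int_le[OF pos])
      show "continuous_on (sphere 0 \<rho>) (\<lambda>w. scale_op (1 / w) (resolvent S w))"
        using pos by (intro continuous_on_sphere_resolvent[OF S pos sph] continuous_intros) auto
      fix z :: complex assume "z \<in> sphere 0 \<rho>"
      then have z: "cmod z = \<rho>" by simp
      then have "norm (resolvent S z) \<le> 1 / (\<rho> - norm S)"
        using resolvent_outside_norm(3)[OF closed_subalgebra_bounded_ops id_in_bounded_ops S, of z]
          rho by simp
      then have "1 / \<rho> * norm (resolvent S z) \<le> 1 / \<rho> * (1 / (\<rho> - norm S))"
        using pos by (intro mult_left_mono) auto
      then show "norm (scale_op (1 / z) (resolvent S z)) \<le> 1 / \<rho> * (1 / (\<rho> - norm S))"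
        by (simp add: norm_scale_op norm_divide z)
    qed (use rho pos in auto)
    then have K: "norm K \<le> 1 / (\<rho> - norm S)" using pos by simp
    have "(scale_op 0 id_blinfun - S) o\<^sub>L K = id_blinfun - ?J \<rho>"
      using circle_int_Cauchy_kernel[OF S pos sph, of 0] pos by (simp add: K_def)
    then have "id_blinfun - ?J \<epsilon> = - S o\<^sub>L K"
      by (simp add: same[OF rho(1)])
    then have "norm (id_blinfun - ?J \<epsilon>) \<le> norm S * norm K"
      using norm_blinfun_compose[of "- S" K] by simp
    also have "\<dots> \<le> norm S * (1 / (\<rho> - norm S))"
      by (intro mult_left_mono K) simp
    finally show ?thesis .
  qed
  have "((\<lambda>\<rho>. norm S * (1 / (\<rho> - norm S))) \<longlongrightarrow> norm S * 0) at_top"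
    by (intro tendsto_intros tendsto_divide_0 filterlim_at_top_imp_at_infinity
        filterlim_tendsto_add_at_top[of "\<lambda>_. - norm S", simplified]) (auto simp: filterlim_ident)
  moreover have "\<forall>\<^sub>F \<rho> in at_top. norm (id_blinfun - ?J \<epsilon>) \<le> norm S * (1 / (\<rho> - norm S))"
    using eventually_gt_at_top[of "max \<epsilon> (norm S)"] by eventually_elim (intro bound; simp)
  ultimately have "norm (id_blinfun - ?J \<epsilon>) \<le> norm S * 0"
    by (intro tendsto_lowerbound) auto
  then show ?thesis by simp
qed

text \<open>
  This estimate does the work of the spectral radius formula.
\<close>

lemma norm_op_power_le_spectral:
  assumes S: "S \<in> bounded_ops" and eps: "0 < \<epsilon>" and out: "Sp S \<subseteq> ball 0 \<epsilon>"
  shows "\<exists>C\<ge>0. \<forall>n. norm (op_power S n) \<le> C * \<epsilon> ^ n"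
proof -
  have "sphere 0 \<epsilon> \<inter> Sp S = {}" using out by auto
  from norm_op_power_compose_circle_int[OF S eps this] show ?thesis
    by (simp add: circle_int_resolvent_eq_id[OF assms])
qed

section \<open>The minimal spectral idempotents as circle integrals\<close>

text \<open>
  The cycle consists of a small circle about \<open>\<mu>\<close>, a circle slightly larger than the isolating
  disc, run backwards, and a circle around everything.
\<close>

lemma surrounding_cycle_exists:
  assumes K: "compact K" and r: "0 < r" "K \<inter> cball \<mu> r = {\<mu>}"
  shows "\<exists>\<Gamma>. surrounds \<Gamma> K (ball \<mu> r \<union> - cball \<mu> r)"
proof -
  obtain s where s: "r < s" "\<And>w. w \<in> K \<Longrightarrow> w \<noteq> \<mu> \<Longrightarrow> s < dist \<mu> w"
  proof (cases "K - ball \<mu> r = {}")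
    case True
    show thesis
    proof (rule that[of "r + 1"])
      fix w assume w: "w \<in> K" "w \<noteq> \<mu>"
      then have "w \<in> ball \<mu> r" using True by blast
      then have "w \<in> K \<inter> cball \<mu> r" using w by auto
      then show "r + 1 < dist \<mu> w" using r w by blast
    qed simp
  next
    case False
    moreover have "compact (K - ball \<mu> r)"
      using K by (rule compact_diff) simp
    moreover have "continuous_on (K - ball \<mu> r) (dist \<mu>)"
      by (intro continuous_intros)
    ultimately obtain v where v: "v \<in> K - ball \<mu> r" "\<And>w. w \<in> K - ball \<mu> r \<Longrightarrow> dist \<mu> v \<le> dist \<mu> w"
      using continuous_attains_inf[of "K - ball \<mu> r" "dist \<mu>"] by blast
    have far: "r < dist \<mu> w" if "w \<in> K" "w \<noteq> \<mu>" for w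
      using r that by (metis IntI linorder_not_less mem_cball singletonD)
    have "v \<noteq> \<mu>" using v(1) r(1) by auto
    then have rv: "r < dist \<mu> v" using far v(1) by blast
    show thesis
    proof (rule that[of "(r + dist \<mu> v) / 2"])
      fix w assume w: "w \<in> K" "w \<noteq> \<mu>"
      then have "dist \<mu> v \<le> dist \<mu> w" using far[OF w] v(2) by simp
      then show "(r + dist \<mu> v) / 2 < dist \<mu> w" using rv by simp
    qed (use rv in simp)
  qed
  obtain R0 where R0: "K \<subseteq> ball \<mu> R0"
    using bounded_subset_ballD[OF compact_imp_bounded[OF K]] by blast
  define R where "R = max R0 (s + 1)"
  have R: "s < R" "K \<subseteq> ball \<mu> R"
    using R0 by (auto simp: R_def)
  have inner: "winding_number (circlepath \<mu> t) w = 1" if "dist \<mu> w < t" for w t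
    using that by (intro winding_number_circlepath) (simp add: dist_norm norm_minus_commute)
  have outer: "winding_number (circlepath \<mu> t) w = 0" if "t < dist \<mu> w" "0 < t" for w t
    using that by (intro winding_number_zero_outside[OF _ convex_cball[of \<mu> t]]) auto
  have rev: "winding_number (reversepath (circlepath \<mu> s)) w = - winding_number (circlepath \<mu> s) w"
    if "dist \<mu> w \<noteq> s" for w
    using that r s by (intro winding_number_reversepath) auto
  have "surrounds [circlepath \<mu> (r / 2), reversepath (circlepath \<mu> s), circlepath \<mu> R] K
      (ball \<mu> r \<union> - cball \<mu> r)"
    unfolding surrounds_def
  proof (intro conjI ballI allI impI)
    fix w assume w: "w \<in> K"
    show "(\<Sum>\<gamma>\<leftarrow>[circlepath \<mu> (r / 2), reversepath (circlepath \<mu> s), circlepath \<mu> R].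
        winding_number \<gamma> w) = 1"
    proof (cases "w = \<mu>")
      case True
      then show ?thesis using r s R by (simp add: inner rev)
    next
      case False
      then have "s < dist \<mu> w" "dist \<mu> w < R" using s(2)[OF w] R(2) w by auto
      then show ?thesis using r s by (simp add: inner outer rev)
    qed
  next
    fix w assume "w \<notin> ball \<mu> r \<union> - cball \<mu> r"
    then have "dist \<mu> w = r" by auto
    then show "(\<Sum>\<gamma>\<leftarrow>[circlepath \<mu> (r / 2), reversepath (circlepath \<mu> s), circlepath \<mu> R].
        winding_number \<gamma> w) = 0"
      using r s R by (simp add: inner outer rev)
  next
    fix \<gamma> assume "\<gamma> \<in> set [circlepath \<mu> (r / 2), reversepath (circlepath \<mu> s), circlepath \<mu> R]"
    then consider "\<gamma> = circlepath \<mu> (r / 2)" | "\<gamma> = reversepath (circlepath \<mu> s)" | "\<gamma> = circlepath \<mu> R"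
      by auto
    note \<gamma> = this
    have far: "w \<notin> K" if "dist \<mu> w = t" "t \<in> {r / 2, s, R}" for w t
    proof
      assume w: "w \<in> K"
      have "w \<noteq> \<mu>" using that r s R by auto
      then show False using s(1) s(2)[OF w] R w that r by auto
    qed
    show "valid_path \<gamma>"
      using \<gamma> by cases (auto intro: valid_path_imp_reverse)
    show "pathfinish \<gamma> = pathstart \<gamma>"
      using \<gamma> by cases auto
    show "path_image \<gamma> \<subseteq> ball \<mu> r \<union> - cball \<mu> r - K"
      using \<gamma> by cases (use r s R far in auto)
  qed
  then show ?thesis by blast
qed

definition riesz_idempotent ::
    "('h::complex_hilbert \<Rightarrow>\<^sub>L 'h) \<Rightarrow> complex \<Rightarrow> real \<Rightarrow> ('h \<Rightarrow>\<^sub>L 'h)" where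
  "riesz_idempotent T \<mu> \<rho> = circle_int \<mu> \<rho> (resolvent T)"

text \<open>
  Whatever surrounding cycle the functional calculus uses, a path of it contributes \<open>2 \<pi> i\<close> times
  the residue of the resolvent, weighted by the difference of its winding numbers about \<open>\<mu>\<close> and
  about a point of the bounding circle: inside the disc the second number vanishes, and outside the
  disc the two agree. Summed over the cycle these differences give 1.
\<close>

lemma analytic_calculus_eq_riesz_idempotent:
  assumes T: "T \<in> bounded_ops" and r: "0 < r" "Sp T \<inter> cball \<mu> r = {\<mu>}" and rho: "0 < \<rho>" "\<rho> < r"
  shows "analytic_calculus T (ball \<mu> r \<union> - cball \<mu> r) (indicator (ball \<mu> r)) = riesz_idempotent T \<mu> \<rho>"
proof (rule eq_if_coef_eq)
  fix x y
  define U where "U = ball \<mu> r \<union> - cball \<mu> r"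
  define \<Gamma> where "\<Gamma> = (SOME \<Gamma>. surrounds \<Gamma> (Sp T) U)"
  have "surrounds \<Gamma> (Sp T) U"
    unfolding \<Gamma>_def U_def by (rule someI_ex[OF surrounding_cycle_exists[OF compact_Sp[OF T] r]])
  then have path: "\<And>\<gamma>. \<gamma> \<in> set \<Gamma> \<Longrightarrow> valid_path \<gamma> \<and> pathfinish \<gamma> = pathstart \<gamma> \<and> path_image \<gamma> \<subseteq> U - Sp T"
    and w1: "(\<Sum>\<gamma>\<leftarrow>\<Gamma>. winding_number \<gamma> \<mu>) = 1"
    and w0: "(\<Sum>\<gamma>\<leftarrow>\<Gamma>. winding_number \<gamma> (\<mu> + of_real r)) = 0"
    using r by (auto simp: surrounds_def U_def dist_norm)
  let ?f = "\<lambda>z. coef x y (resolvent T z)"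
  let ?F = "\<lambda>z. scale_op (indicator (ball \<mu> r) z) (resolvent T z)"
  let ?c = "2 * of_real pi * \<i> * residue ?f \<mu>"
  have disc: "ball \<mu> r - {\<mu>} \<subseteq> - Sp T"
  proof
    fix z assume z: "z \<in> ball \<mu> r - {\<mu>}"
    then have "z \<in> cball \<mu> r" by simp
    then show "z \<in> - Sp T" using r(2) z by blast
  qed
  have holo: "?f holomorphic_on ball \<mu> r - {\<mu>}"
    using coef_resolvent_holomorphic disc by (rule holomorphic_on_subset)
  have one: "coef x y (op_contour_integral \<gamma> ?F)
      = ?c * (winding_number \<gamma> \<mu> - winding_number \<gamma> (\<mu> + of_real r))" if "\<gamma> \<in> set \<Gamma>" for \<gamma>
  proof -
    have \<gamma>: "valid_path \<gamma>" "pathfinish \<gamma> = pathstart \<gamma>" "path_image \<gamma> \<subseteq> U - Sp T"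
      using path[OF that] by auto
    have "connected (path_image \<gamma>)"
      by (simp add: \<gamma> connected_path_image valid_path_imp_path)
    then have "ball \<mu> r \<inter> path_image \<gamma> = {} \<or> - cball \<mu> r \<inter> path_image \<gamma> = {}"
      using \<gamma>(3) by (intro connectedD) (auto simp: U_def)
    then consider "path_image \<gamma> \<subseteq> ball \<mu> r - {\<mu>}" | "path_image \<gamma> \<subseteq> - cball \<mu> r"
      using \<gamma>(3) r(2) by (auto simp: U_def)
    then show ?thesis
    proof cases
      case 1
      have eq: "?F z = resolvent T z" if "z \<in> ball \<mu> r - {\<mu>}" for z
        using that by simp
      have "coef x y (op_contour_integral \<gamma> ?F) = contour_integral \<gamma> (\<lambda>z. coef x y (?F z))"
      proof (rule contour_integral_unique[symmetric, OF coef_op_contour_integral])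
        show "(\<lambda>t. scale_op (vector_derivative \<gamma> (at t within {0..1})) (?F (\<gamma> t))) integrable_on {0..1}"
        proof (rule operator_integrable_along[OF _ _ _ \<gamma>(1) 1])
          show "continuous_on (ball \<mu> r - {\<mu>}) ?F"
            using continuous_on_subset[OF continuous_on_resolvent disc]
            by (rule continuous_on_eq) simp
          show "(\<lambda>z. coef u v (?F z)) holomorphic_on ball \<mu> r - {\<mu>}" for u v
            using holomorphic_on_subset[OF coef_resolvent_holomorphic disc]
            by (rule holomorphic_transform) simp
        qed auto
      qed
      also have "\<dots> = contour_integral \<gamma> ?f"
        using 1 by (intro contour_integral_eq) (auto simp: eq)
      also have "\<dots> = 2 * pi * \<i> * (\<Sum>p\<in>{\<mu>}. winding_number \<gamma> p * residue ?f p)"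
        by (rule Residue_theorem[OF open_ball connected_ball _ holo \<gamma>(1,2) 1])
          (use \<gamma> 1 in \<open>auto intro!: winding_number_zero_outside[OF _ convex_ball[of \<mu> r]]
              simp: valid_path_imp_path\<close>)
      also have "\<dots> = ?c * winding_number \<gamma> \<mu>"
        by simp
      finally have "coef x y (op_contour_integral \<gamma> ?F) = ?c * winding_number \<gamma> \<mu>" .
      moreover have "winding_number \<gamma> (\<mu> + of_real r) = 0"
        using \<gamma> 1 r by (intro winding_number_zero_outside[OF _ convex_ball[of \<mu> r]])
          (auto simp: valid_path_imp_path dist_norm)
      ultimately show ?thesis by simp
    next
      case 2
      have "op_contour_integral \<gamma> ?F = integral {0..1} (\<lambda>_::real. 0)"
        unfolding op_contour_integral_def
      proof (rule integral_cong)
        fix t :: real assume "t \<in> {0..1}"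
        then have "\<gamma> t \<in> - cball \<mu> r" using 2 unfolding path_image_def by blast
        then show "scale_op (vector_derivative \<gamma> (at t within {0..1})) (?F (\<gamma> t)) = 0"
          by simp
      qed
      moreover have "winding_number \<gamma> \<mu> = winding_number \<gamma> (\<mu> + of_real r)"
        using \<gamma> 2 r by (intro winding_number_eq[of _ _ "cball \<mu> r"])
          (auto simp: valid_path_imp_path dist_norm)
      ultimately show ?thesis by (simp add: coef_simps)
    qed
  qed
  have "coef x y (\<Sum>\<gamma>\<leftarrow>\<Gamma>. op_contour_integral \<gamma> ?F)
      = (\<Sum>\<gamma>\<leftarrow>\<Gamma>. coef x y (op_contour_integral \<gamma> ?F))"
    by (induction \<Gamma>) (simp_all add: coef_simps)
  also have "\<dots> = (\<Sum>\<gamma>\<leftarrow>\<Gamma>. ?c * (winding_number \<gamma> \<mu> - winding_number \<gamma> (\<mu> + of_real r)))"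
    by (intro arg_cong[of _ _ sum_list] map_cong refl one)
  also have "\<dots> = ?c * ((\<Sum>\<gamma>\<leftarrow>\<Gamma>. winding_number \<gamma> \<mu>) - (\<Sum>\<gamma>\<leftarrow>\<Gamma>. winding_number \<gamma> (\<mu> + of_real r)))"
    by (simp only: sum_list_const_mult sum_list_subtractf)
  also have "\<dots> = ?c" by (simp only: w1 w0 diff_zero mult_1_right)
  finally have cycle: "coef x y (\<Sum>\<gamma>\<leftarrow>\<Gamma>. op_contour_integral \<gamma> ?F) = ?c" .
  have "sphere \<mu> \<rho> \<subseteq> ball \<mu> r - {\<mu>}" using rho by auto
  then have "continuous_on (sphere \<mu> \<rho>) (resolvent T)"
    using disc by (intro continuous_on_subset[OF continuous_on_resolvent]) blast
  from coef_circle_int[OF rho(1) this, of x y]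
  have "(?f has_contour_integral 2 * of_real pi * \<i> * coef x y (riesz_idempotent T \<mu> \<rho>)) (circlepath \<mu> \<rho>)"
    by (simp add: riesz_idempotent_def)
  moreover have "(?f has_contour_integral 2 * pi * \<i> * residue ?f \<mu>) (circlepath \<mu> \<rho>)"
    using rho by (intro base_residue[OF open_ball _ _ holo]) auto
  ultimately have "2 * of_real pi * \<i> * coef x y (riesz_idempotent T \<mu> \<rho>) = ?c"
    using has_contour_integral_unique by fastforce
  then have "coef x y (riesz_idempotent T \<mu> \<rho>) = residue ?f \<mu>"
    by simp
  then show "coef x y (analytic_calculus T (ball \<mu> r \<union> - cball \<mu> r) (indicator (ball \<mu> r)))
      = coef x y (riesz_idempotent T \<mu> \<rho>)"
    unfolding analytic_calculus_def Let_def U_def[symmetric] \<Gamma>_def[symmetric]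
    by (simp add: coef_scale_op cycle)
qed

section \<open>The algebra generated by one operator\<close>

text \<open>
  The inverses that occur below live here, as does the resolvent of an operator with countable
  spectrum, and the algebra generated by \<open>T\<close> alone is an ideal of it.
\<close>

definition unital_algebra :: "('h::complex_hilbert \<Rightarrow>\<^sub>L 'h) \<Rightarrow> ('h \<Rightarrow>\<^sub>L 'h) set" where
  "unital_algebra T = closed_algebra {id_blinfun, T}"

lemma subspace_closure:
  fixes S :: "'a::real_normed_vector set"
  assumes S: "subspace S"
  shows "subspace (closure S)"
  unfolding subspace_def
proof (intro conjI ballI allI)
  show "0 \<in> closure S" using subspace_0[OF S] closure_subset by blast
next
  fix x y assume "x \<in> closure S" "y \<in> closure S"
  then obtain f g where "\<forall>n. f n \<in> S" "f \<longlonglongrightarrow> x" "\<forall>n. g n \<in> S" "g \<longlonglongrightarrow> y"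
    unfolding closure_sequential by blast
  then show "x + y \<in> closure S"
    unfolding closure_sequential using subspace_add[OF S]
    by (intro exI[of _ "\<lambda>n. f n + g n"]) (auto intro: tendsto_add)
next
  fix c x assume "x \<in> closure S"
  then obtain f where "\<forall>n. f n \<in> S" "f \<longlonglongrightarrow> x"
    unfolding closure_sequential by blast
  then show "c *\<^sub>R x \<in> closure S"
    unfolding closure_sequential using subspace_scale[OF S]
    by (intro exI[of _ "\<lambda>n. c *\<^sub>R f n"]) (auto intro: tendsto_scaleR)
qed

context
  fixes T :: "'h::complex_hilbert \<Rightarrow>\<^sub>L 'h"
  assumes T: "T \<in> bounded_ops"
begin

lemma singleton_subset_bounded_ops: "{T} \<subseteq> bounded_ops" "{id_blinfun, T} \<subseteq> bounded_ops"
  using T id_in_bounded_ops by auto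

lemmas algebra_closed = closed_algebra_properties(1)[OF singleton_subset_bounded_ops(1)]
lemmas algebra_least = closed_algebra_properties(3)[OF singleton_subset_bounded_ops(1)]
lemmas unital_closed =
  closed_algebra_properties(1)[OF singleton_subset_bounded_ops(2), folded unital_algebra_def]
lemmas unital_least =
  closed_algebra_properties(3)[OF singleton_subset_bounded_ops(2), folded unital_algebra_def]
lemmas algebraD = closed_subalgebraD[OF algebra_closed]
lemmas unitalD = closed_subalgebraD[OF unital_closed]

lemma generator_in: "T \<in> closed_algebra {T}" "T \<in> unital_algebra T" "id_blinfun \<in> unital_algebra T"
  using closed_algebra_properties(2)[OF singleton_subset_bounded_ops(1)]
    closed_algebra_properties(2)[OF singleton_subset_bounded_ops(2)]
  by (auto simp: unital_algebra_def)

lemma algebra_subset_unital: "closed_algebra {T} \<subseteq> unital_algebra T"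
  by (rule algebra_least[OF unital_closed]) (simp add: generator_in)

lemma unital_commute:
  assumes "a \<in> unital_algebra T" "b \<in> unital_algebra T"
  shows "a o\<^sub>L b = b o\<^sub>L a"
proof -
  have "unital_algebra T \<subseteq> {a \<in> bounded_ops. \<forall>s\<in>{T}. a o\<^sub>L s = s o\<^sub>L a}"
    using T id_in_bounded_ops by (intro unital_least closed_commutant) auto
  then have "\<And>a. a \<in> unital_algebra T \<Longrightarrow> a o\<^sub>L T = T o\<^sub>L a" by blast
  then have "unital_algebra T \<subseteq> {a \<in> bounded_ops. \<forall>s\<in>unital_algebra T. a o\<^sub>L s = s o\<^sub>L a}"
    using T id_in_bounded_ops by (intro unital_least[OF closed_commutant[OF unitalD(1)]]) simp
  then show ?thesis using assms by blast
qed

lemma unital_left_commute: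
  assumes "a \<in> unital_algebra T" "b \<in> unital_algebra T"
  shows "a o\<^sub>L (b o\<^sub>L c) = b o\<^sub>L (a o\<^sub>L c)"
  by (simp only: unital_commute[OF assms] flip: compose_assoc)

lemma unital_power_in: "a \<in> unital_algebra T \<Longrightarrow> op_power a n \<in> unital_algebra T"
  by (rule op_power_in[OF unital_closed generator_in(3)])

lemma unital_mult_algebra:
  assumes "u \<in> unital_algebra T" "a \<in> closed_algebra {T}"
  shows "u o\<^sub>L a \<in> closed_algebra {T}"
proof -
  let ?A = "closed_algebra {T}" and ?L = "{u \<in> bounded_ops. \<forall>a\<in>closed_algebra {T}. u o\<^sub>L a \<in> closed_algebra {T}}"
  note b = closed_subalgebraD[OF closed_subalgebra_bounded_ops]
  have "closed_subalgebra ?L"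
    unfolding closed_subalgebra_def[of ?L]
  proof (intro conjI ballI allI)
    have "?L = bounded_ops \<inter> (\<Inter>a\<in>?A. (\<lambda>u. u o\<^sub>L a) -` ?A)" by auto
    also have "closed \<dots>"
      by (intro closed_Int b(2) closed_INT ballI continuous_closed_vimage algebraD(2)
          continuous_intros)
    finally show "closed ?L" .
  next
    fix u v assume "u \<in> ?L" "v \<in> ?L"
    then show "u + v \<in> ?L" "u o\<^sub>L v \<in> ?L"
      using b(4,6) algebraD(4) by (auto simp: compose_simps compose_assoc)
  next
    fix u c assume "u \<in> ?L"
    then show "scale_op c u \<in> ?L"
      using b(5) algebraD(5) by (auto simp: scale_op_compose)
  qed (use b(3) algebraD(3) in auto)
  moreover have "{id_blinfun, T} \<subseteq> ?L"
    using T id_in_bounded_ops algebraD(6) generator_in by auto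
  ultimately show ?thesis using unital_least assms by blast
qed

lemma algebra_mult_unital:
  assumes "u \<in> unital_algebra T" "a \<in> closed_algebra {T}"
  shows "a o\<^sub>L u \<in> closed_algebra {T}"
proof -
  have "a o\<^sub>L u = u o\<^sub>L a"
    using assms algebra_subset_unital by (intro unital_commute) auto
  then show ?thesis using unital_mult_algebra[OF assms] by simp
qed

text \<open>
  The elements of the unital algebra that are limits of multiples of \<open>T\<close> form a closed subalgebra
  containing \<open>T\<close>.
\<close>

lemma algebra_approx:
  assumes "a \<in> closed_algebra {T}" "0 < e"
  shows "\<exists>w\<in>unital_algebra T. norm (a - (T o\<^sub>L w)) < e"
proof -
  let ?I = "(\<lambda>w. T o\<^sub>L w) ` unital_algebra T"
  let ?L = "unital_algebra T \<inter> closure ?I"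
  have "subspace ?I"
    by (intro linear_subspace_image closed_subalgebra_subspace unital_closed bounded_linear.linear
        bounded_bilinear.bounded_linear_right[OF bounded_bilinear_blinfun_compose])
  then have sub: "subspace (closure ?I)" by (rule subspace_closure)
  have mult: "b o\<^sub>L a \<in> closure ?I" if "b \<in> unital_algebra T" "a \<in> closure ?I" for a b
  proof -
    have "(\<lambda>a. b o\<^sub>L a) ` closure ?I \<subseteq> closure ?I"
    proof (rule image_closure_subset)
      show "(\<lambda>a. b o\<^sub>L a) ` ?I \<subseteq> closure ?I"
      proof clarify
        fix w assume w: "w \<in> unital_algebra T"
        have "b o\<^sub>L (T o\<^sub>L w) = T o\<^sub>L (b o\<^sub>L w)"
          by (rule unital_left_commute[OF that(1) generator_in(2)])
        then show "b o\<^sub>L (T o\<^sub>L w) \<in> closure ?I"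
          using unitalD(6)[OF that(1) w] closure_subset by (metis image_eqI subsetD)
      qed
    qed (auto intro!: continuous_intros)
    then show ?thesis using that(2) by blast
  qed
  have "closed_subalgebra ?L"
    unfolding closed_subalgebra_def[of ?L]
  proof (intro conjI ballI allI)
    show "?L \<subseteq> bounded_ops" "closed ?L"
      using unitalD(1,2) by auto
    show "0 \<in> ?L" using unitalD(3) subspace_0[OF sub] by blast
  next
    fix a b assume ab: "a \<in> ?L" "b \<in> ?L"
    show "a + b \<in> ?L" using ab unitalD(4) subspace_add[OF sub] by blast
    show "a o\<^sub>L b \<in> ?L" using ab unitalD(6) mult by blast
  next
    fix a c assume a: "a \<in> ?L"
    have "scale_op c id_blinfun \<in> unital_algebra T"
      by (intro unitalD(5) generator_in)
    then have "scale_op c a \<in> closure ?I"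
      using mult[of "scale_op c id_blinfun" a] a by (simp add: scale_op_compose)
    then show "scale_op c a \<in> ?L" using a unitalD(5) by blast
  qed
  moreover have "T \<in> ?L"
  proof -
    have "T o\<^sub>L id_blinfun \<in> ?I" using generator_in(3) by blast
    then show ?thesis using generator_in(2) closure_subset[of ?I] by auto
  qed
  ultimately have "a \<in> closure ?I"
    using algebra_least[of ?L] assms(1) by blast
  then obtain w where "w \<in> unital_algebra T" "dist (T o\<^sub>L w) a < e"
    using assms(2) by (auto simp: closure_approachable)
  then show ?thesis by (auto simp: dist_norm norm_minus_commute)
qed


section \<open>Modular ideals\<close>

text \<open>
  Modulo \<open>M\<close> the element \<open>u m\<close> is \<open>(e u) m\<close> with \<open>e\<close> a modular identity, and \<open>e u\<close> belongs to
  the algebra.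
\<close>

lemma ideal_mult_unital:
  assumes M: "modular_ideal (closed_algebra {T}) M" and u: "u \<in> unital_algebra T" and m: "m \<in> M"
  shows "u o\<^sub>L m \<in> M"
proof -
  let ?A = "closed_algebra {T}"
  from M obtain e where e: "e \<in> ?A" "\<And>a. a \<in> ?A \<Longrightarrow> a - (e o\<^sub>L a) \<in> M"
    and I: "ideal_of ?A M"
    unfolding modular_ideal_def by blast
  have um: "u o\<^sub>L m \<in> ?A"
    using I m u unital_mult_algebra by (auto simp: ideal_of_def)
  have "(e o\<^sub>L u) o\<^sub>L m \<in> M"
    using algebra_mult_unital[OF u e(1)] I m by (auto simp: ideal_of_def)
  moreover have "(u o\<^sub>L m) - (e o\<^sub>L (u o\<^sub>L m)) \<in> M"
    by (rule e(2)[OF um])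
  ultimately have "((u o\<^sub>L m) - (e o\<^sub>L (u o\<^sub>L m))) + ((e o\<^sub>L u) o\<^sub>L m) \<in> M"
    using I by (simp only: ideal_of_def)
  then show ?thesis by (simp add: compose_assoc)
qed

text \<open>
  Every \<open>a\<close> has the form \<open>s - q s\<close> with \<open>s = v a\<close>, and modulo \<open>M\<close> multiplication by \<open>q\<close> is
  multiplication by the modular identity \<open>e\<close>, which fixes \<open>s\<close>.
\<close>

lemma modular_ideal_improper:
  assumes M: "ideal_of (closed_algebra {T}) M"
    and e: "\<And>a. a \<in> closed_algebra {T} \<Longrightarrow> a - (e o\<^sub>L a) \<in> M"
    and q: "e - q \<in> M" and v: "v \<in> unital_algebra T" "(id_blinfun - q) o\<^sub>L v = id_blinfun"
  shows "M = closed_algebra {T}"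
proof
  show "M \<subseteq> closed_algebra {T}" using M by (simp add: ideal_of_def)
  show "closed_algebra {T} \<subseteq> M"
  proof
    fix a assume a: "a \<in> closed_algebra {T}"
    define s where "s = v o\<^sub>L a"
    have s: "s \<in> closed_algebra {T}"
      unfolding s_def by (rule unital_mult_algebra[OF v(1) a])
    have "s - (e o\<^sub>L s) \<in> M" by (rule e[OF s])
    moreover have "(e - q) o\<^sub>L s \<in> M" using M q s by (auto simp: ideal_of_def)
    ultimately have "(s - (e o\<^sub>L s)) + ((e - q) o\<^sub>L s) \<in> M"
      using M by (simp only: ideal_of_def)
    moreover have "(s - (e o\<^sub>L s)) + ((e - q) o\<^sub>L s) = ((id_blinfun - q) o\<^sub>L v) o\<^sub>L a"
      by (simp add: s_def compose_simps compose_assoc)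
    ultimately show "a \<in> M" by (simp add: v(2))
  qed
qed

text \<open>
  \<open>M\<close> together with the multiples of \<open>D\<close> is an ideal strictly larger than \<open>M\<close>.
\<close>

lemma maximal_modular_ideal_generate:
  assumes M: "maximal_modular_ideal (closed_algebra {T}) M"
    and D: "D \<in> closed_algebra {T}" "D \<notin> M" and e: "e \<in> closed_algebra {T}"
  shows "\<exists>m\<in>M. \<exists>u\<in>unital_algebra T. e = m + (u o\<^sub>L D)"
proof -
  let ?A = "closed_algebra {T}"
  let ?I = "{m + (u o\<^sub>L D) | m u. m \<in> M \<and> u \<in> unital_algebra T}"
  have MI: "ideal_of ?A M" and max: "\<And>I. ideal_of ?A I \<Longrightarrow> M \<subseteq> I \<Longrightarrow> I = M \<or> I = ?A"
    using M by (auto simp: maximal_modular_ideal_def modular_ideal_def)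
  have I_intro: "m + (u o\<^sub>L D) \<in> ?I" if "m \<in> M" "u \<in> unital_algebra T" for m u
    using that by blast
  have "ideal_of ?A ?I"
    unfolding ideal_of_def[of ?A ?I]
  proof (intro conjI ballI allI)
    show "?I \<subseteq> ?A"
      using MI algebraD(4) unital_mult_algebra[OF _ D(1)] by (auto simp: ideal_of_def)
    show "0 \<in> ?I"
      using I_intro[of 0 0] MI unitalD(3) by (auto simp: ideal_of_def)
  next
    fix a b assume "a \<in> ?I" "b \<in> ?I"
    then obtain m u n v where "m \<in> M" "u \<in> unital_algebra T" "a = m + (u o\<^sub>L D)"
      and "n \<in> M" "v \<in> unital_algebra T" "b = n + (v o\<^sub>L D)" by blast
    then show "a + b \<in> ?I"
      using I_intro[of "m + n" "u + v"] MI unitalD(4)[of u v]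
      by (simp add: ideal_of_def compose_simps add_ac)
  next
    fix a c assume "a \<in> ?I"
    then obtain m u where "m \<in> M" "u \<in> unital_algebra T" "a = m + (u o\<^sub>L D)" by blast
    then show "scale_op c a \<in> ?I"
      using I_intro[of "scale_op c m" "scale_op c u"] MI unitalD(5)[of u c]
      by (simp add: ideal_of_def scale_op_simps scale_op_compose)
  next
    fix a b assume a: "a \<in> ?A" and "b \<in> ?I"
    then obtain m u where b: "m \<in> M" "u \<in> unital_algebra T" "b = m + (u o\<^sub>L D)" by blast
    have aU: "a \<in> unital_algebra T" using a algebra_subset_unital by blast
    have "a o\<^sub>L m \<in> M" using MI a b(1) by (simp add: ideal_of_def)
    then show ab: "a o\<^sub>L b \<in> ?I"
      using I_intro[of "a o\<^sub>L m" "a o\<^sub>L u"] unitalD(6)[OF aU b(2)]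
      by (simp add: b(3) compose_simps compose_assoc)
    have "m \<in> unital_algebra T" "D \<in> unital_algebra T"
      using b(1) D(1) MI algebra_subset_unital by (auto simp: ideal_of_def)
    then have "b \<in> unital_algebra T"
      unfolding b(3) by (intro unitalD(4,6) b(2))
    then show "b o\<^sub>L a \<in> ?I" using ab unital_commute[OF aU] by simp
  qed
  moreover have "M \<subseteq> ?I"
    using I_intro[of _ 0] unitalD(3) by auto
  moreover have "D \<in> ?I"
    using I_intro[of 0 id_blinfun] MI generator_in(3) by (simp add: ideal_of_def)
  ultimately have "?I = ?A" using max D(2) by blast
  then show ?thesis using e by blast
qed

lemma in_jacobson_radicalI:
  assumes N: "N \<in> closed_algebra {T}"
    and inv: "\<And>u. u \<in> unital_algebra T \<Longrightarrow> \<exists>v\<in>unital_algebra T. (id_blinfun - (u o\<^sub>L N)) o\<^sub>L v = id_blinfun"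
  shows "N \<in> jacobson_radical (closed_algebra {T})"
  unfolding jacobson_radical_def
proof (intro IntI N InterI)
  fix M assume "M \<in> {M. maximal_modular_ideal (closed_algebra {T}) M}"
  then have M: "maximal_modular_ideal (closed_algebra {T}) M" by simp
  then have mod: "modular_ideal (closed_algebra {T}) M" and proper: "M \<noteq> closed_algebra {T}"
    by (simp_all add: maximal_modular_ideal_def)
  then obtain e where e: "e \<in> closed_algebra {T}"
      "\<And>a. a \<in> closed_algebra {T} \<Longrightarrow> a - (e o\<^sub>L a) \<in> M"
    and MI: "ideal_of (closed_algebra {T}) M"
    by (auto simp: modular_ideal_def)
  show "N \<in> M"
  proof (rule ccontr)
    assume "N \<notin> M"
    then obtain m u where mu: "m \<in> M" "u \<in> unital_algebra T" "e = m + (u o\<^sub>L N)"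
      using maximal_modular_ideal_generate[OF M N _ e(1)] by blast
    moreover obtain v where "v \<in> unital_algebra T" "(id_blinfun - (u o\<^sub>L N)) o\<^sub>L v = id_blinfun"
      using inv[OF mu(2)] by blast
    ultimately show False
      using modular_ideal_improper[OF MI e(2), of "u o\<^sub>L N" v] proper by simp
  qed
qed

text \<open>
  In a commutative algebra the powers of \<open>u X Y\<close> are dominated by a geometric series as soon as
  \<open>X^n Y\<close> decays fast enough.
\<close>

lemma invertible_if_geometric:
  assumes X: "X \<in> unital_algebra T" and Y: "Y \<in> unital_algebra T" and u: "u \<in> unital_algebra T"
    and bound: "\<And>n. norm (op_power X n o\<^sub>L Y) \<le> C * \<rho> ^ n" and "0 \<le> C" "0 \<le> \<rho>"
    and small: "norm (u o\<^sub>L Y) * \<rho> < 1"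
  shows "\<exists>v\<in>unital_algebra T. (id_blinfun - (u o\<^sub>L (X o\<^sub>L Y))) o\<^sub>L v = id_blinfun"
proof -
  let ?q = "u o\<^sub>L (X o\<^sub>L Y)" and ?b = "u o\<^sub>L Y"
  have in_U: "?q \<in> unital_algebra T" "?b \<in> unital_algebra T"
    using X Y u unitalD(6) by auto
  have pow: "op_power ?q (Suc n) = (op_power ?b n o\<^sub>L u) o\<^sub>L (op_power X (Suc n) o\<^sub>L Y)" for n
  proof (induction n)
    case (Suc n)
    have "op_power ?q (Suc (Suc n))
        = (u o\<^sub>L (X o\<^sub>L Y)) o\<^sub>L ((op_power ?b n o\<^sub>L u) o\<^sub>L (op_power X (Suc n) o\<^sub>L Y))"
      by (simp only: op_power.simps(2)[of ?q "Suc n"] Suc.IH)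
    also have "\<dots> = ((u o\<^sub>L Y) o\<^sub>L op_power ?b n o\<^sub>L u) o\<^sub>L ((X o\<^sub>L op_power X (Suc n)) o\<^sub>L Y)"
    proof -
      have U: "op_power ?b n \<in> unital_algebra T" "op_power X (Suc n) \<in> unital_algebra T"
        using unital_power_in in_U X by blast+
      have "X o\<^sub>L (Y o\<^sub>L (op_power ?b n o\<^sub>L (u o\<^sub>L (op_power X (Suc n) o\<^sub>L Y))))
          = Y o\<^sub>L (op_power ?b n o\<^sub>L (u o\<^sub>L (X o\<^sub>L (op_power X (Suc n) o\<^sub>L Y))))"
        by (simp only: unital_left_commute[OF X Y] unital_left_commute[OF X U(1)]
            unital_left_commute[OF X u])
      then show ?thesis by (simp only: compose_assoc)
    qed
    finally show ?case by simp
  qed (simp add: compose_assoc)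
  have "summable (\<lambda>n. norm (op_power ?q (Suc n)))"
  proof (rule summable_comparison_test)
    show "summable (\<lambda>n. (norm u * C * \<rho>) * (norm ?b * \<rho>) ^ n)"
      using small assms(6) by (intro summable_mult summable_geometric) simp
    have "norm (op_power ?q (Suc n)) \<le> (norm u * C * \<rho>) * (norm ?b * \<rho>) ^ n" for n
    proof -
      have "norm (op_power ?q (Suc n)) \<le> norm (op_power ?b n o\<^sub>L u) * norm (op_power X (Suc n) o\<^sub>L Y)"
        unfolding pow by (rule norm_blinfun_compose)
      also have "\<dots> \<le> (norm (op_power ?b n) * norm u) * (C * \<rho> ^ Suc n)"
        by (intro mult_mono norm_blinfun_compose bound) auto
      also have "\<dots> \<le> (norm ?b ^ n * norm u) * (C * \<rho> ^ Suc n)"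
        using assms(5,6) by (intro mult_right_mono norm_op_power_le) auto
      finally show ?thesis by (simp add: power_mult_distrib mult_ac)
    qed
    then show "\<exists>N. \<forall>n\<ge>N. norm (norm (op_power ?q (Suc n))) \<le> (norm u * C * \<rho>) * (norm ?b * \<rho>) ^ n"
      by simp
  qed
  then have "summable (\<lambda>n. norm (op_power ?q n))"
    by (simp only: summable_Suc_iff[of "\<lambda>n. norm (op_power ?q n)"])
  then show ?thesis
    using Neumann_series[OF unital_closed generator_in(3) in_U(1)] by blast
qed

end

section \<open>Spectral idempotents in the generated algebra\<close>

text \<open>
  The radius is left free below some bound because the circles are chosen according to need: small
  enough to exclude 0, or to make powers decay.
\<close>

definition spectral_idempotent_at ::
    "('h::complex_hilbert \<Rightarrow>\<^sub>L 'h) \<Rightarrow> complex \<Rightarrow> ('h \<Rightarrow>\<^sub>L 'h) \<Rightarrow> bool" where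
  "spectral_idempotent_at T \<mu> p \<longleftrightarrow> \<mu> \<in> Sp T \<and> \<mu> \<noteq> 0 \<and>
     (\<exists>r>0. Sp T \<inter> cball \<mu> r = {\<mu>} \<and> (\<forall>\<rho>. 0 < \<rho> \<longrightarrow> \<rho> < r \<longrightarrow> p = riesz_idempotent T \<mu> \<rho>))"

lemma minimal_spectral_idempotent_at:
  assumes T: "T \<in> bounded_ops" and p: "p \<in> minimal_spectral_idempotents T"
  shows "\<exists>\<mu>. spectral_idempotent_at T \<mu> p"
proof -
  obtain \<mu> r where \<mu>: "\<mu> isolated_in Sp T" "\<mu> \<noteq> 0" "r > 0" "Sp T \<inter> cball \<mu> r = {\<mu>}"
    and eq: "p = analytic_calculus T (ball \<mu> r \<union> - cball \<mu> r) (indicator (ball \<mu> r))"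
    using p unfolding minimal_spectral_idempotents_def by blast
  then show ?thesis
    using analytic_calculus_eq_riesz_idempotent[OF T \<mu>(3,4)]
    unfolding spectral_idempotent_at_def by blast
qed

context
  fixes T :: "'h::complex_hilbert \<Rightarrow>\<^sub>L 'h"
  assumes T: "T \<in> bounded_ops" and no_limit: "\<forall>z. z islimpt Sp T \<longrightarrow> z = 0"
begin

lemma minimal_spectral_idempotent_exists:
  assumes "\<mu> \<in> Sp T" "\<mu> \<noteq> 0"
  shows "\<exists>p\<in>minimal_spectral_idempotents T. spectral_idempotent_at T \<mu> p"
proof -
  have "\<not> \<mu> islimpt Sp T" using no_limit assms by blast
  then obtain e where e: "e > 0" "\<And>z. z \<in> Sp T \<Longrightarrow> z \<noteq> \<mu> \<Longrightarrow> e \<le> dist z \<mu>"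
    unfolding islimpt_approachable by (meson linorder_not_less)
  have r: "Sp T \<inter> cball \<mu> (e / 2) = {\<mu>}"
  proof (intro equalityI subsetI)
    fix z assume z: "z \<in> Sp T \<inter> cball \<mu> (e / 2)"
    then have "\<not> e \<le> dist z \<mu>" using e(1) by (simp add: dist_commute)
    then show "z \<in> {\<mu>}" using e(2)[of z] z by blast
  qed (use assms e in auto)
  have "ball \<mu> (e / 2) \<inter> Sp T = {\<mu>}"
  proof
    show "ball \<mu> (e / 2) \<inter> Sp T \<subseteq> {\<mu>}"
      using r ball_subset_cball[of \<mu> "e / 2"] by blast
  qed (use e(1) assms(1) in simp)
  then have "\<mu> isolated_in Sp T"
    unfolding isolated_in_def using assms(1) open_ball by blast
  then have "analytic_calculus T (ball \<mu> (e / 2) \<union> - cball \<mu> (e / 2)) (indicator (ball \<mu> (e / 2)))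
      \<in> minimal_spectral_idempotents T"
    unfolding minimal_spectral_idempotents_def using assms(2) e(1) r by (blast intro: half_gt_zero)
  moreover have "spectral_idempotent_at T \<mu>
      (analytic_calculus T (ball \<mu> (e / 2) \<union> - cball \<mu> (e / 2)) (indicator (ball \<mu> (e / 2))))"
    unfolding spectral_idempotent_at_def
    using analytic_calculus_eq_riesz_idempotent[OF T _ r] assms e(1) r
    by (intro conjI exI[of _ "e / 2"]) auto
  ultimately show ?thesis by blast
qed

lemma finite_spectrum_away_from_0:
  assumes "0 < \<epsilon>"
  shows "finite (Sp T - ball 0 \<epsilon>)"
proof (rule ccontr)
  assume inf: "infinite (Sp T - ball 0 \<epsilon>)"
  have "compact (Sp T - ball 0 \<epsilon>)"
    by (intro compact_diff compact_Sp T) simp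
  then obtain z where z: "z \<in> Sp T - ball 0 \<epsilon>" "z islimpt (Sp T - ball 0 \<epsilon>)"
    using Heine_Borel_imp_Bolzano_Weierstrass[OF _ inf] by blast
  then have "z = 0" using no_limit islimpt_subset by blast
  then show False using z(1) assms by simp
qed

lemma countable_spectrum: "countable (Sp T)"
proof -
  have "Sp T \<subseteq> {0} \<union> (\<Union>n. Sp T - ball 0 (1 / real (Suc n)))"
  proof
    fix z assume z: "z \<in> Sp T"
    show "z \<in> {0} \<union> (\<Union>n. Sp T - ball 0 (1 / real (Suc n)))"
    proof (cases "z = 0")
      case False
      then obtain n where "1 / real (Suc n) < cmod z"
        using nat_approx_posE[of "cmod z"] by auto
      then have "z \<in> Sp T - ball 0 (1 / real (Suc n))" using z by simp
      then show ?thesis by blast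
    qed simp
  qed
  moreover have "countable (Sp T - ball 0 (1 / real (Suc n)))" for n
    by (intro countable_finite finite_spectrum_away_from_0) simp
  then have "countable (\<Union>n. Sp T - ball 0 (1 / real (Suc n)))"
    by (intro countable_UN countableI_type)
  then have "countable ({0} \<union> (\<Union>n. Sp T - ball 0 (1 / real (Suc n))))"
    by (simp only: countable_Un_iff countable_insert_eq countable_empty simp_thms)
  ultimately show ?thesis by (rule countable_subset)
qed

text \<open>
  This is where the hypothesis on the limit points of the spectrum enters through countability.
\<close>

lemma resolvent_in_unital: "z \<notin> Sp T \<Longrightarrow> resolvent T z \<in> unital_algebra T"
  by (rule resolvent_in_closed_subalgebra[OF unital_closed[OF T] generator_in(3)[OF T] generator_in(2)[OF T]
        countable_spectrum])

lemma shift_in_unital: "scale_op z id_blinfun - T \<in> unital_algebra T"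
  "T - scale_op z id_blinfun \<in> unital_algebra T"
  by (intro unitalD[OF T] generator_in[OF T])+

context
  fixes \<mu> p
  assumes p: "spectral_idempotent_at T \<mu> p"
begin

lemma spectral_circle:
  assumes "0 < b"
  obtains \<rho> where "0 < \<rho>" "\<rho> < b" "sphere \<mu> \<rho> \<inter> Sp T = {}" "p = circle_int \<mu> \<rho> (resolvent T)"
proof -
  obtain r where r: "r > 0" "Sp T \<inter> cball \<mu> r = {\<mu>}"
      "\<And>\<rho>. 0 < \<rho> \<Longrightarrow> \<rho> < r \<Longrightarrow> p = riesz_idempotent T \<mu> \<rho>"
    using p by (auto simp: spectral_idempotent_at_def)
  define \<rho> where "\<rho> = min r b / 2"
  have rho: "0 < \<rho>" "\<rho> < r" "\<rho> < b" using r(1) assms by (auto simp: \<rho>_def)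
  have "sphere \<mu> \<rho> \<inter> Sp T = {}"
  proof (rule ccontr)
    assume "sphere \<mu> \<rho> \<inter> Sp T \<noteq> {}"
    then obtain z where "z \<in> sphere \<mu> \<rho>" "z \<in> Sp T" by blast
    then have z: "dist \<mu> z = \<rho>" "z \<in> Sp T" by simp_all
    then have "z \<in> Sp T \<inter> cball \<mu> r" using rho by simp
    then show False using r(2) z(1) rho(1) by auto
  qed
  then show thesis
    using r(3)[OF rho(1,2)] by (intro that[OF rho(1,3)]) (simp_all add: riesz_idempotent_def)
qed

lemma Cauchy_kernel_in_unital:
  assumes "0 < \<rho>" "sphere \<mu> \<rho> \<inter> Sp T = {}" "continuous_on (sphere \<mu> \<rho>) h"
  shows "circle_int \<mu> \<rho> (\<lambda>w. scale_op (h w) (resolvent T w)) \<in> unital_algebra T"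
  using assms(2)
  by (intro circle_int_in[OF unital_closed[OF T] assms(1)] unitalD(5)[OF T] resolvent_in_unital
      continuous_on_sphere_resolvent[OF T assms]) auto

text \<open>
  The circle is chosen so small that 0 lies outside; the Cauchy kernel at 0 then writes \<open>p\<close> as a
  multiple of \<open>T\<close>.
\<close>

lemma spectral_idempotent_in: "p \<in> unital_algebra T" "p \<in> closed_algebra {T}"
proof -
  have "0 < cmod \<mu>" using p by (simp add: spectral_idempotent_at_def)
  then obtain \<rho> where \<rho>: "0 < \<rho>" "\<rho> < cmod \<mu>" "sphere \<mu> \<rho> \<inter> Sp T = {}"
      "p = circle_int \<mu> \<rho> (resolvent T)"
    using spectral_circle by metis
  define K where "K = circle_int \<mu> \<rho> (\<lambda>w. scale_op (1 / (w - 0)) (resolvent T w))"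
  have outside: "0 \<notin> sphere \<mu> \<rho>" "0 \<notin> ball \<mu> \<rho>" using \<rho>(2) by auto
  have "K \<in> unital_algebra T"
    unfolding K_def using outside(1) \<rho>(2)
    by (intro Cauchy_kernel_in_unital \<rho> continuous_intros) auto
  then have "T o\<^sub>L K \<in> closed_algebra {T}"
    by (intro algebra_mult_unital[OF T] generator_in[OF T])
  moreover have "(scale_op 0 id_blinfun - T) o\<^sub>L K = 0 - p"
    unfolding K_def \<rho>(4) circle_int_Cauchy_kernel[OF T \<rho>(1,3) outside(1)]
    using outside(2) by (simp only: if_False)
  then have "T o\<^sub>L K = p"
    by (simp add: compose_simps)
  ultimately show A: "p \<in> closed_algebra {T}" by simp
  then show "p \<in> unital_algebra T"
    using algebra_subset_unital[OF T] by blast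
qed

lemma inverse_off_spectral_idempotent:
  "\<exists>G\<in>unital_algebra T. (scale_op \<mu> id_blinfun - T) o\<^sub>L G = id_blinfun - p"
proof -
  obtain \<rho> where \<rho>: "0 < \<rho>" "sphere \<mu> \<rho> \<inter> Sp T = {}" "p = circle_int \<mu> \<rho> (resolvent T)"
    using spectral_circle[of 1] by auto
  have in_ball: "\<mu> \<notin> sphere \<mu> \<rho>" "\<mu> \<in> ball \<mu> \<rho>" using \<rho>(1) by auto
  show ?thesis
  proof
    show "(scale_op \<mu> id_blinfun - T) o\<^sub>L circle_int \<mu> \<rho> (\<lambda>w. scale_op (1 / (w - \<mu>)) (resolvent T w))
        = id_blinfun - p"
      using circle_int_Cauchy_kernel[OF T \<rho>(1,2) in_ball(1)] in_ball(2) by (simp add: \<rho>(3))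
    show "circle_int \<mu> \<rho> (\<lambda>w. scale_op (1 / (w - \<mu>)) (resolvent T w)) \<in> unital_algebra T"
      using in_ball(1) by (intro Cauchy_kernel_in_unital \<rho> continuous_intros) auto
  qed
qed

text \<open>
  On the range of \<open>p\<close> the operator \<open>T - \<mu>\<close> is quasinilpotent, since its powers are integrals of
  \<open>(z - \<mu>)^n\<close> times the resolvent over arbitrarily small circles. Semisimplicity leaves no room for
  such elements.
\<close>

lemma semisimple_eigenvalue:
  assumes ss: "semisimple (closed_algebra {T})"
  shows "(T - scale_op \<mu> id_blinfun) o\<^sub>L p = 0"
proof -
  let ?X = "T - scale_op \<mu> id_blinfun"
  have "?X o\<^sub>L p \<in> jacobson_radical (closed_algebra {T})"
  proof (rule in_jacobson_radicalI[OF T])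
    show "?X o\<^sub>L p \<in> closed_algebra {T}"
      by (rule unital_mult_algebra[OF T shift_in_unital(2) spectral_idempotent_in(2)])
    fix u assume u: "u \<in> unital_algebra T"
    define b where "b = 1 / (norm (u o\<^sub>L p) + 1)"
    have "0 < b" by (simp add: b_def add_nonneg_pos)
    then obtain \<rho> where \<rho>: "0 < \<rho>" "\<rho> < b" "sphere \<mu> \<rho> \<inter> Sp T = {}"
        "p = circle_int \<mu> \<rho> (resolvent T)"
      using spectral_circle by metis
    obtain C where C: "C \<ge> 0" "\<And>n. norm (op_power ?X n o\<^sub>L p) \<le> C * \<rho> ^ n"
      using norm_op_power_compose_circle_int[OF T \<rho>(1,3)] by (auto simp: \<rho>(4)[symmetric])
    have "norm (u o\<^sub>L p) * \<rho> \<le> norm (u o\<^sub>L p) * b"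
      using \<rho>(2) by (intro mult_left_mono) auto
    also have "\<dots> < 1" by (simp add: b_def divide_less_eq add_nonneg_pos)
    finally show "\<exists>v\<in>unital_algebra T. (id_blinfun - (u o\<^sub>L (?X o\<^sub>L p))) o\<^sub>L v = id_blinfun"
      using \<rho>(1)
      by (intro invertible_if_geometric[OF T shift_in_unital(2) spectral_idempotent_in(1) u C(2,1)])
        auto
  qed
  then show ?thesis using ss by (simp add: semisimple_def)
qed

lemma semisimple_compose_idempotent:
  assumes "semisimple (closed_algebra {T})"
  shows "T o\<^sub>L p = scale_op \<mu> p"
  using semisimple_eigenvalue[OF assms] by (simp add: compose_simps scale_op_compose)

text \<open>
  With \<open>G\<close> inverting \<open>\<mu> - T\<close> up to \<open>p\<close>, the product \<open>(id - p) p\<close> equals \<open>G (\<mu> - T) p\<close>, which is zero.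
\<close>

lemma semisimple_idempotent:
  assumes "semisimple (closed_algebra {T})"
  shows "p o\<^sub>L p = p"
proof -
  obtain G where G: "G \<in> unital_algebra T" "(scale_op \<mu> id_blinfun - T) o\<^sub>L G = id_blinfun - p"
    using inverse_off_spectral_idempotent by blast
  have "(id_blinfun - p) o\<^sub>L p = G o\<^sub>L ((scale_op \<mu> id_blinfun - T) o\<^sub>L p)"
    unfolding G(2)[symmetric]
    by (simp only: unital_commute[OF T shift_in_unital(1) G(1)] compose_assoc)
  also have "(scale_op \<mu> id_blinfun - T) o\<^sub>L p = 0"
    by (simp add: compose_simps scale_op_compose semisimple_compose_idempotent[OF assms])
  finally show ?thesis by (simp add: compose_simps)
qed

end

end

section \<open>Elements annihilated by the spectral idempotents\<close>

context
  fixes T :: "'h::complex_hilbert \<Rightarrow>\<^sub>L 'h"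
  assumes T: "T \<in> bounded_ops" and no_limit: "\<forall>z. z islimpt Sp T \<longrightarrow> z = 0"
begin

lemma minimal_spectral_idempotents_subset: "minimal_spectral_idempotents T \<subseteq> closed_algebra {T}"
  using minimal_spectral_idempotent_at[OF T] spectral_idempotent_in(2)[OF T no_limit] by blast

text \<open>
  \<open>Q\<close> is the product of the complements \<open>id - p\<close> over the finitely many spectral points in \<open>F\<close>.
\<close>

lemma cutoff_idempotent_exists:
  assumes ss: "semisimple (closed_algebra {T})"
    and I: "ideal_of (closed_algebra {T}) M" and E: "minimal_spectral_idempotents T \<subseteq> M"
    and "finite F" "F \<subseteq> Sp T - {0}"
  shows "\<exists>Q\<in>unital_algebra T. id_blinfun - Q \<in> M \<and> Q o\<^sub>L Q = Q \<and>
    (\<forall>\<mu>\<in>F. \<exists>G\<in>unital_algebra T. (scale_op \<mu> id_blinfun - T) o\<^sub>L (G o\<^sub>L Q) = Q)"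
  using assms(4,5)
proof (induction F)
  case empty
  show ?case
    using generator_in(3)[OF T] I by (intro bexI[of _ id_blinfun]) (auto simp: ideal_of_def)
next
  case (insert \<mu> F)
  then obtain Q where Q: "Q \<in> unital_algebra T" "id_blinfun - Q \<in> M" "Q o\<^sub>L Q = Q"
    and old: "\<And>\<nu>. \<nu> \<in> F \<Longrightarrow> \<exists>G\<in>unital_algebra T. (scale_op \<nu> id_blinfun - T) o\<^sub>L (G o\<^sub>L Q) = Q"
    by auto
  have "\<mu> \<in> Sp T" "\<mu> \<noteq> 0" using insert.prems by auto
  then obtain p where pE: "p \<in> minimal_spectral_idempotents T" and p: "spectral_idempotent_at T \<mu> p"
    using minimal_spectral_idempotent_exists[OF T no_limit] by blast
  have pM: "p \<in> M" using pE E by blast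
  have pU: "p \<in> unital_algebra T" by (rule spectral_idempotent_in(1)[OF T no_limit p])
  have pp: "p o\<^sub>L p = p" by (rule semisimple_idempotent[OF T no_limit p ss])
  let ?c = "id_blinfun - p"
  have cU: "?c \<in> unital_algebra T" by (intro unitalD(8)[OF T] generator_in(3)[OF T] pU)
  have cc: "?c o\<^sub>L ?c = ?c" by (simp add: compose_simps pp)
  note lc = unital_left_commute[OF T]
  have "?c o\<^sub>L Q \<in> unital_algebra T" by (intro unitalD(6)[OF T] cU Q)
  moreover have "id_blinfun - (?c o\<^sub>L Q) \<in> M"
  proof -
    have QpA: "Q o\<^sub>L p \<in> M"
    proof -
      have "Q o\<^sub>L p = p - ((id_blinfun - Q) o\<^sub>L p)" by (simp add: compose_simps)
      moreover have "p \<in> closed_algebra {T}" using I pM by (auto simp: ideal_of_def)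
      then have "(id_blinfun - Q) o\<^sub>L p \<in> M" using I Q(2) by (simp add: ideal_of_def)
      then have "scale_op (-1) ((id_blinfun - Q) o\<^sub>L p) \<in> M" using I unfolding ideal_of_def by blast
      then have "p + scale_op (-1) ((id_blinfun - Q) o\<^sub>L p) \<in> M"
        using I pM unfolding ideal_of_def by blast
      ultimately show ?thesis by (simp add: scale_op_minus_one)
    qed
    have "id_blinfun - (?c o\<^sub>L Q) = (id_blinfun - Q) + (Q o\<^sub>L p)"
      by (simp add: compose_simps unital_commute[OF T pU Q(1)])
    also have "\<dots> \<in> M" using I Q(2) QpA unfolding ideal_of_def by blast
    finally show ?thesis .
  qed
  moreover have "(?c o\<^sub>L Q) o\<^sub>L (?c o\<^sub>L Q) = ?c o\<^sub>L Q"
  proof -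
    have "(?c o\<^sub>L Q) o\<^sub>L (?c o\<^sub>L Q) = (?c o\<^sub>L ?c) o\<^sub>L (Q o\<^sub>L Q)"
      by (simp only: compose_assoc lc[OF Q(1) cU])
    then show ?thesis by (simp only: cc Q(3))
  qed
  moreover have "\<exists>G\<in>unital_algebra T. (scale_op \<nu> id_blinfun - T) o\<^sub>L (G o\<^sub>L (?c o\<^sub>L Q)) = ?c o\<^sub>L Q"
    if "\<nu> \<in> insert \<mu> F" for \<nu>
  proof (cases "\<nu> = \<mu>")
    case True
    obtain G where G: "G \<in> unital_algebra T" "(scale_op \<mu> id_blinfun - T) o\<^sub>L G = ?c"
      using inverse_off_spectral_idempotent[OF T no_limit p] by blast
    have "(scale_op \<mu> id_blinfun - T) o\<^sub>L (G o\<^sub>L (?c o\<^sub>L Q)) = (?c o\<^sub>L ?c) o\<^sub>L Q"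
      unfolding G(2)[symmetric] by (simp only: compose_assoc)
    then show ?thesis using G(1) True by (auto simp: cc)
  next
    case False
    then obtain G where G: "G \<in> unital_algebra T" "(scale_op \<nu> id_blinfun - T) o\<^sub>L (G o\<^sub>L Q) = Q"
      using old \<open>\<nu> \<in> insert \<mu> F\<close> by blast
    have "(scale_op \<nu> id_blinfun - T) o\<^sub>L (G o\<^sub>L (?c o\<^sub>L Q))
        = ?c o\<^sub>L ((scale_op \<nu> id_blinfun - T) o\<^sub>L (G o\<^sub>L Q))"
      by (simp only: lc[OF G(1) cU] lc[OF shift_in_unital(1)[OF T no_limit] cU])
    then show ?thesis using G by auto
  qed
  ultimately show ?case by blast
qed

text \<open>
  The algebra splits along \<open>Q\<close>: on its range \<open>z - T Q\<close> acts as \<open>z - T\<close>, which \<open>G\<close> inverts there,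
  and on the complement it acts as \<open>z\<close>.
\<close>

lemma cutoff_spectrum:
  assumes Q: "Q \<in> unital_algebra T" "Q o\<^sub>L Q = Q" and "0 < \<epsilon>"
    and inv: "\<And>\<mu>. \<mu> \<in> Sp T - ball 0 \<epsilon> \<Longrightarrow>
      \<exists>G\<in>unital_algebra T. (scale_op \<mu> id_blinfun - T) o\<^sub>L (G o\<^sub>L Q) = Q"
  shows "Sp (T o\<^sub>L Q) \<subseteq> ball 0 \<epsilon>"
proof
  fix z assume z: "z \<in> Sp (T o\<^sub>L Q)"
  show "z \<in> ball 0 \<epsilon>"
  proof (rule ccontr)
    assume out: "z \<notin> ball 0 \<epsilon>"
    then have "z \<noteq> 0" using assms(3) by auto
    obtain G where G: "G \<in> unital_algebra T" "(scale_op z id_blinfun - T) o\<^sub>L (G o\<^sub>L Q) = Q"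
    proof (cases "z \<in> Sp T")
      case True
      then show thesis using inv out that by blast
    next
      case False
      then show thesis
        using resolventD(3)[OF False] resolvent_in_unital[OF T no_limit False]
        by (intro that[of "resolvent T z"]) (simp_all flip: compose_assoc)
    qed
    note TU = generator_in(2)[OF T]
    define W where "W = (G o\<^sub>L Q) + scale_op (1 / z) (id_blinfun - Q)"
    have U: "scale_op z id_blinfun - (T o\<^sub>L Q) \<in> unital_algebra T" "W \<in> unital_algebra T"
      unfolding W_def by (intro unitalD(4,5,6,8)[OF T] generator_in[OF T] G Q)+
    have TQQ: "T o\<^sub>L (Q o\<^sub>L (G o\<^sub>L Q)) = T o\<^sub>L (G o\<^sub>L Q)"
      by (simp only: unital_left_commute[OF T Q(1) G(1)] Q(2))
    have "(scale_op z id_blinfun - (T o\<^sub>L Q)) o\<^sub>L (G o\<^sub>L Q) = Q"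
      using G(2) by (simp add: compose_simps(3) compose_assoc TQQ)
    moreover have "(scale_op z id_blinfun - (T o\<^sub>L Q)) o\<^sub>L scale_op (1 / z) (id_blinfun - Q)
        = id_blinfun - Q"
    proof -
      have "(T o\<^sub>L Q) o\<^sub>L scale_op (1 / z) (id_blinfun - Q) = scale_op (1 / z) (T o\<^sub>L (Q o\<^sub>L (id_blinfun - Q)))"
        using unitalD(1,6)[OF T] TU Q(1) by (subst compose_scale_op) (auto simp: compose_assoc)
      also have "Q o\<^sub>L (id_blinfun - Q) = 0" by (simp add: compose_simps Q(2))
      finally show ?thesis
        using \<open>z \<noteq> 0\<close> by (simp add: compose_simps(3) scale_op_compose)
    qed
    ultimately have "(scale_op z id_blinfun - (T o\<^sub>L Q)) o\<^sub>L W = id_blinfun"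
      unfolding W_def by (simp add: compose_simps(2))
    then have "is_resolvent_at (T o\<^sub>L Q) z W"
      using unital_commute[OF T U] U(2) unitalD(1)[OF T] by (auto simp: is_resolvent_at_def)
    then show False using resolventI(1) z by blast
  qed
qed

text \<open>
  A maximal modular ideal that misses \<open>D\<close> contains every spectral idempotent, so modulo it \<open>T\<close>
  agrees with operators of arbitrarily small spectral radius. Hence it contains \<open>T\<close>, and with \<open>T\<close>
  approximately its own modular identity.
\<close>

lemma annihilator_in_radical:
  assumes ss: "semisimple (closed_algebra {T})"
    and D: "D \<in> closed_algebra {T}" and ann: "\<And>p. p \<in> minimal_spectral_idempotents T \<Longrightarrow> D o\<^sub>L p = 0"
  shows "D \<in> jacobson_radical (closed_algebra {T})"
  unfolding jacobson_radical_def
proof (intro IntI D InterI)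
  fix M assume "M \<in> {M. maximal_modular_ideal (closed_algebra {T}) M}"
  then have M: "maximal_modular_ideal (closed_algebra {T}) M" by simp
  then have mod: "modular_ideal (closed_algebra {T}) M" and proper: "M \<noteq> closed_algebra {T}"
    by (simp_all add: maximal_modular_ideal_def)
  then obtain e where e: "e \<in> closed_algebra {T}"
      "\<And>a. a \<in> closed_algebra {T} \<Longrightarrow> a - (e o\<^sub>L a) \<in> M"
    and I: "ideal_of (closed_algebra {T}) M"
    by (auto simp: modular_ideal_def)
  have add: "a + b \<in> M" if "a \<in> M" "b \<in> M" for a b
    using I that by (simp add: ideal_of_def)
  note TA = generator_in(1)[OF T] and TU = generator_in(2)[OF T]
  show "D \<in> M"
  proof (rule ccontr)
    assume "D \<notin> M"
    then obtain m u where mu: "m \<in> M" "u \<in> unital_algebra T" "e = m + (u o\<^sub>L D)"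
      using maximal_modular_ideal_generate[OF T M D _ e(1)] by blast
    \<comment> \<open>modulo \<open>M\<close>, \<open>p\<close> is \<open>e p = m p + u D p\<close>, and \<open>D p = 0\<close>\<close>
    have E: "minimal_spectral_idempotents T \<subseteq> M"
    proof
      fix p assume p: "p \<in> minimal_spectral_idempotents T"
      then have pA: "p \<in> closed_algebra {T}" using minimal_spectral_idempotents_subset by blast
      have "e o\<^sub>L p = m o\<^sub>L p"
        by (simp add: mu(3) compose_simps compose_assoc ann[OF p])
      moreover have "m o\<^sub>L p \<in> M" using I pA mu(1) by (simp add: ideal_of_def)
      ultimately have "(p - (e o\<^sub>L p)) + (e o\<^sub>L p) \<in> M"
        using add[OF e(2)[OF pA]] by metis
      then show "p \<in> M" by simp
    qed
    \<comment> \<open>otherwise the modular identity would be congruent to the quasi-invertible \<open>u T Q\<close>\<close>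
    have "T \<in> M"
    proof (rule ccontr)
      assume "T \<notin> M"
      then obtain m u where mu: "m \<in> M" "u \<in> unital_algebra T" "e = m + (u o\<^sub>L T)"
        using maximal_modular_ideal_generate[OF T M TA _ e(1)] by blast
      \<comment> \<open>small enough for \<open>u T\<close>, cut off at \<open>\<epsilon>\<close>, to have a convergent Neumann series\<close>
      define \<epsilon> where "\<epsilon> = 1 / (norm u + 1)"
      have eps: "0 < \<epsilon>" "norm u * \<epsilon> < 1"
        by (simp_all add: \<epsilon>_def add_nonneg_pos divide_less_eq)
      have fin: "finite (Sp T - ball 0 \<epsilon>)" "Sp T - ball 0 \<epsilon> \<subseteq> Sp T - {0}"
        using finite_spectrum_away_from_0[OF T no_limit eps(1)] eps(1) by auto
      obtain Q where Q: "Q \<in> unital_algebra T" "id_blinfun - Q \<in> M" "Q o\<^sub>L Q = Q"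
        and inv: "\<And>\<mu>. \<mu> \<in> Sp T - ball 0 \<epsilon> \<Longrightarrow>
          \<exists>G\<in>unital_algebra T. (scale_op \<mu> id_blinfun - T) o\<^sub>L (G o\<^sub>L Q) = Q"
        using cutoff_idempotent_exists[OF ss I E fin] by blast
      have S: "T o\<^sub>L Q \<in> unital_algebra T" by (rule unitalD(6)[OF T TU Q(1)])
      then have "T o\<^sub>L Q \<in> bounded_ops" using unitalD(1)[OF T] by blast
      from norm_op_power_le_spectral[OF this eps(1) cutoff_spectrum[OF Q(1,3) eps(1) inv]]
      obtain C where C: "C \<ge> 0" "\<And>n. norm (op_power (T o\<^sub>L Q) n) \<le> C * \<epsilon> ^ n"
        by blast
      have "\<exists>v\<in>unital_algebra T. (id_blinfun - (u o\<^sub>L ((T o\<^sub>L Q) o\<^sub>L id_blinfun))) o\<^sub>L v = id_blinfun"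
        using C eps by (intro invertible_if_geometric[OF T S generator_in(3)[OF T] mu(2)]) auto
      then obtain v where v: "v \<in> unital_algebra T" "(id_blinfun - (u o\<^sub>L (T o\<^sub>L Q))) o\<^sub>L v = id_blinfun"
        by auto
      have "(u o\<^sub>L T) o\<^sub>L (id_blinfun - Q) \<in> M"
        by (rule ideal_mult_unital[OF T mod unitalD(6)[OF T mu(2) TU] Q(2)])
      then have "m + ((u o\<^sub>L T) o\<^sub>L (id_blinfun - Q)) \<in> M" by (rule add[OF mu(1)])
      then have "e - (u o\<^sub>L (T o\<^sub>L Q)) \<in> M"
        by (simp add: mu(3) compose_simps compose_assoc add_diff_eq)
      then show False
        using modular_ideal_improper[OF T I e(2) _ v] proper by blast
    qed
    \<comment> \<open>now \<open>e\<close> is congruent to \<open>e - T w\<close>, which has norm less than 1\<close>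
    obtain w where w: "w \<in> unital_algebra T" "norm (e - (T o\<^sub>L w)) < 1"
      using algebra_approx[OF T e(1), of 1] by auto
    have "e - (T o\<^sub>L w) \<in> unital_algebra T"
      using e(1) algebra_subset_unital[OF T] by (intro unitalD(6,8)[OF T] TU w(1)) auto
    then obtain v where v: "v \<in> unital_algebra T" "(id_blinfun - (e - (T o\<^sub>L w))) o\<^sub>L v = id_blinfun"
      using Neumann_series_contraction[OF unital_closed[OF T] generator_in(3)[OF T] _ w(2)] by blast
    have "e - (e - (T o\<^sub>L w)) = w o\<^sub>L T"
      by (simp add: unital_commute[OF T TU w(1)])
    also have "\<dots> \<in> M" by (rule ideal_mult_unital[OF T mod w(1) \<open>T \<in> M\<close>])
    finally show False
      using modular_ideal_improper[OF T I e(2) _ v] proper by blast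
  qed
qed

end


section \<open>Weak cluster points\<close>

text \<open>
  The compactness argument for filters: a point of the weakly compact set all of whose weak
  neighbourhoods are visited frequently. Every functional that converges along the filter takes
  its limit as value there.
\<close>

lemma weak_cluster_point:
  assumes wc: "weakly_compact_operator A L" and "F \<noteq> bot"
    and LA: "L ` (A \<inter> cball 0 1) \<subseteq> A" and ev: "\<forall>\<^sub>F e in F. g e \<in> L ` (A \<inter> cball 0 1)"
  obtains S where "S \<in> A"
    "\<And>\<psi> l. \<psi> \<in> dual_of A \<Longrightarrow> ((\<lambda>e. \<psi> (g e)) \<longlongrightarrow> l) F \<Longrightarrow> \<psi> S = l"
proof -
  let ?X = "weak_topology A" and ?K = "weak_topology A closure_of (L ` (A \<inter> cball 0 1))"
  have dual0: "(\<lambda>_. 0) \<in> dual_of A"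
    by (auto simp: dual_of_def intro: exI[of _ 0])
  have open_gen: "openin ?X {a\<in>A. \<psi> a \<in> V}" if "\<psi> \<in> dual_of A" "open V" for \<psi> V
    unfolding weak_topology_def using that by (intro topology_generated_by_Basis) blast
  have top: "topspace ?X = A"
  proof -
    have "{a\<in>A. (\<lambda>_. 0::complex) a \<in> (UNIV::complex set)} = A" by simp
    then have "openin ?X A" using open_gen[OF dual0 open_UNIV] by simp
    moreover have "topspace ?X \<subseteq> A"
      unfolding weak_topology_def topology_generated_by_topspace by blast
    ultimately show ?thesis by (simp add: openin_subset subset_antisym)
  qed
  have comp: "compactin ?X ?K" using wc by (simp add: weakly_compact_operator_def)
  have K: "\<forall>\<^sub>F e in F. g e \<in> ?K"
    using ev by eventually_elim (use closure_of_subset[of _ ?X] LA top in blast)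
  have "\<exists>S\<in>?K. \<forall>U. openin ?X U \<longrightarrow> S \<in> U \<longrightarrow> (\<exists>\<^sub>F e in F. g e \<in> U)"
  proof (rule ccontr)
    assume "\<not> ?thesis"
    then have "\<forall>S\<in>?K. \<exists>U. openin ?X U \<and> S \<in> U \<and> (\<forall>\<^sub>F e in F. g e \<notin> U)"
      by (simp add: not_frequently)
    from bchoice[OF this] obtain U where U: "\<forall>S\<in>?K. openin ?X (U S) \<and> S \<in> U S \<and>
        (\<forall>\<^sub>F e in F. g e \<notin> U S)" by blast
    have "(\<forall>V\<in>U ` ?K. openin ?X V) \<and> ?K \<subseteq> \<Union>(U ` ?K)"
      using U by blast
    then have "\<exists>\<F>. finite \<F> \<and> \<F> \<subseteq> U ` ?K \<and> ?K \<subseteq> \<Union>\<F>"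
      using comp unfolding compactin_def by simp
    then obtain \<F> where \<F>: "finite \<F>" "\<F> \<subseteq> U ` ?K" "?K \<subseteq> \<Union>\<F>" by blast
    have "\<forall>\<^sub>F e in F. \<forall>V\<in>\<F>. g e \<notin> V"
      using \<F>(1) by (rule eventually_ball_finite) (use \<F>(2) U in blast)
    with K have "\<forall>\<^sub>F e in F. False"
    proof eventually_elim
      case (elim e)
      then show ?case using \<F>(3) by blast
    qed
    then show False using \<open>F \<noteq> bot\<close> by simp
  qed
  then obtain S where S: "S \<in> ?K"
    and freq: "\<forall>U. openin ?X U \<longrightarrow> S \<in> U \<longrightarrow> (\<exists>\<^sub>F e in F. g e \<in> U)"
    by (elim bexE)
  have SA: "S \<in> A"
    using subsetD[OF closure_of_subset_topspace S] by (simp only: top)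
  moreover have "\<psi> S = l" if \<psi>: "\<psi> \<in> dual_of A" and lim: "((\<lambda>e. \<psi> (g e)) \<longlongrightarrow> l) F" for \<psi> l
  proof (rule ccontr)
    assume "\<psi> S \<noteq> l"
    then obtain V W where VW: "open V" "open W" "\<psi> S \<in> V" "l \<in> W" "V \<inter> W = {}"
      using hausdorff[OF \<open>\<psi> S \<noteq> l\<close>] by blast
    have "\<exists>\<^sub>F e in F. g e \<in> {a\<in>A. \<psi> a \<in> V}"
      by (rule freq[rule_format, OF open_gen[OF \<psi> VW(1)]]) (use SA VW in simp)
    moreover have "\<forall>\<^sub>F e in F. \<psi> (g e) \<in> W"
      using lim VW(2,4) by (rule topological_tendstoD)
    ultimately have "\<exists>\<^sub>F e in F. g e \<in> {a\<in>A. \<psi> a \<in> V} \<and> \<psi> (g e) \<in> W"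
      by (rule frequently_eventually_frequently)
    then show False using VW(5) by (auto dest: frequently_ex)
  qed
  ultimately show thesis by (rule that)
qed

lemma scale_op_Re_Im: "scale_op c a = Re c *\<^sub>R a + Im c *\<^sub>R scale_op \<i> a"
proof -
  have "c = of_real (Re c) + of_real (Im c) * \<i>"
    by (simp add: complex_eq_iff)
  then have "scale_op c a = scale_op (of_real (Re c) + of_real (Im c) * \<i>) a"
    by (rule arg_cong)
  also have "\<dots> = Re c *\<^sub>R a + scale_op (of_real (Im c)) (scale_op \<i> a)"
    by (simp add: scale_op_simps scale_op_of_real)
  finally show ?thesis by (simp only: scale_op_of_real)
qed

text \<open>
  The passage from real to complex functionals: \<open>f\<close> is the real part, and the imaginary part is
  forced by complex linearity.
\<close>

lemma complexified_functional_in_dual: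
  assumes f: "bounded_linear (f :: ('h::complex_hilbert \<Rightarrow>\<^sub>L 'h) \<Rightarrow> real)"
  shows "(\<lambda>a. of_real (f a) - \<i> * of_real (f (scale_op \<i> a))) \<in> dual_of A"
proof -
  note lin = linear_simps[OF f]
  obtain B where B: "\<And>a. \<bar>f a\<bar> \<le> norm a * B"
    using bounded_linear.bounded[OF f] by auto
  have "of_real (f (scale_op c a)) - \<i> * of_real (f (scale_op \<i> (scale_op c a)))
      = c * (of_real (f a) - \<i> * of_real (f (scale_op \<i> a)))" for c a
  proof -
    have "f (scale_op c a) = Re c * f a + Im c * f (scale_op \<i> a)"
      by (subst scale_op_Re_Im) (simp add: lin)
    moreover have "f (scale_op \<i> (scale_op c a)) = Re c * f (scale_op \<i> a) - Im c * f a"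
      by (simp, subst scale_op_Re_Im) (simp add: lin)
    ultimately show ?thesis by (simp add: complex_eq_iff)
  qed
  moreover have "cmod (of_real (f a) - \<i> * of_real (f (scale_op \<i> a))) \<le> (2 * B) * norm a" for a
  proof -
    have "cmod (of_real (f a) - \<i> * of_real (f (scale_op \<i> a))) \<le> \<bar>f a\<bar> + \<bar>f (scale_op \<i> a)\<bar>"
      by (rule order_trans[OF norm_triangle_ineq4]) (simp add: norm_mult)
    also have "\<dots> \<le> norm a * B + norm (scale_op \<i> a) * B" by (intro add_mono B)
    finally show ?thesis by (simp add: norm_scale_op)
  qed
  moreover have "of_real (f (a + b)) - \<i> * of_real (f (scale_op \<i> (a + b)))
      = (of_real (f a) - \<i> * of_real (f (scale_op \<i> a)))
        + (of_real (f b) - \<i> * of_real (f (scale_op \<i> b)))" for a b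
    by (simp add: lin scale_op_simps algebra_simps)
  ultimately show ?thesis
    unfolding dual_of_def by blast
qed

lemma coef_compose_in_dual: "(\<lambda>a. coef x y (a o\<^sub>L p)) \<in> dual_of A"
proof -
  have "cmod (coef x y (a o\<^sub>L p)) \<le> (norm p * (norm x * norm y)) * norm a" for a
  proof -
    have "cmod (coef x y (a o\<^sub>L p)) \<le> norm (a o\<^sub>L p) * (norm x * norm y)" by (rule norm_coef_le)
    also have "\<dots> \<le> (norm a * norm p) * (norm x * norm y)"
      by (intro mult_right_mono norm_blinfun_compose) simp
    finally show ?thesis by (simp add: mult_ac)
  qed
  then show ?thesis
    unfolding dual_of_def by (auto simp: compose_simps coef_simps scale_op_compose)
qed

theorem corollary1p3:
  fixes T :: "'h::complex_hilbert \<Rightarrow>\<^sub>L 'h"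
  assumes "T \<in> bounded_ops"
    and "\<forall>z. z islimpt Sp T \<longrightarrow> z = 0"
    and "semisimple (closed_algebra {T})"
    and "weakly_compact_algebra (closed_algebra {T})"
    and "has_bounded_approximate_identity (closed_algebra (minimal_spectral_idempotents T))"
  shows "closed_algebra (minimal_spectral_idempotents T) = closed_algebra {T}"
proof -
  note T = assms(1) and no_limit = assms(2) and ss = assms(3)
  let ?E = "minimal_spectral_idempotents T"
  define A where "A = closed_algebra {T}"
  define B where "B = closed_algebra ?E"
  note AD = algebraD[OF T, folded A_def]
  have EA: "?E \<subseteq> A"
    unfolding A_def by (rule minimal_spectral_idempotents_subset[OF T no_limit])
  then have Eb: "?E \<subseteq> bounded_ops" using AD(1) by blast
  note B_closed = closed_algebra_properties(1)[OF Eb, folded B_def]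
    and EB = closed_algebra_properties(2)[OF Eb, folded B_def]
    and B_least = closed_algebra_properties(3)[OF Eb, folded B_def]
  note BD = closed_subalgebraD[OF B_closed]
  have BA: "B \<subseteq> A"
    by (rule B_least[OF algebra_closed[OF T, folded A_def] EA])
  have TA: "T \<in> A" unfolding A_def by (rule generator_in(1)[OF T])
  \<comment> \<open>by \<open>T p = \<mu> p\<close>\<close>
  have TB: "T o\<^sub>L b \<in> B" if "b \<in> B" for b
  proof -
    let ?L = "{b \<in> B. T o\<^sub>L b \<in> B}"
    have "closed_subalgebra ?L"
      unfolding closed_subalgebra_def[of ?L]
    proof (intro conjI ballI allI)
      have "?L = B \<inter> (\<lambda>b. T o\<^sub>L b) -` B" by auto
      also have "closed \<dots>"
        by (intro closed_Int continuous_closed_vimage BD(2) continuous_intros)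
      finally show "closed ?L" .
    next
      fix a b assume "a \<in> ?L" "b \<in> ?L"
      then show "a + b \<in> ?L" "a o\<^sub>L b \<in> ?L"
        using BD(4)[of a b] BD(4)[of "T o\<^sub>L a" "T o\<^sub>L b"] BD(6)[of a b] BD(6)[of "T o\<^sub>L a" b]
        by (simp_all add: compose_simps compose_assoc)
    next
      fix a c assume "a \<in> ?L"
      then show "scale_op c a \<in> ?L"
        using BD(5)[of a c] BD(5)[of "T o\<^sub>L a" c] by (simp add: compose_scale_op[OF T])
    qed (use BD(1,3) in auto)
    moreover have "?E \<subseteq> ?L"
    proof
      fix p assume p: "p \<in> ?E"
      then obtain \<mu> where "spectral_idempotent_at T \<mu> p"
        using minimal_spectral_idempotent_at[OF T] by blast
      from semisimple_compose_idempotent[OF T no_limit this ss]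
      show "p \<in> ?L" using p EB BD(5)[of p \<mu>] by auto
    qed
    ultimately show ?thesis using B_least that by blast
  qed
  from assms(5) obtain F K where F: "F \<noteq> bot" and ev: "\<forall>\<^sub>F e in F. e \<in> B \<and> norm e \<le> K"
    and approx: "\<And>b. b \<in> B \<Longrightarrow> ((\<lambda>e. e o\<^sub>L b) \<longlongrightarrow> b) F"
    unfolding has_bounded_approximate_identity_def B_def[symmetric] by blast
  \<comment> \<open>scales the approximate identity into the unit ball; \<open>K\<close> may be zero or negative\<close>
  define k where "k = 1 / (\<bar>K\<bar> + 1)"
  have k: "0 < k" by (simp add: k_def)
  let ?g = "\<lambda>e. T o\<^sub>L (k *\<^sub>R e)"
  have ev_g: "\<forall>\<^sub>F e in F. ?g e \<in> (\<lambda>b. T o\<^sub>L b) ` (A \<inter> cball 0 1)"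
    using ev
  proof eventually_elim
    case (elim e)
    have "k *\<^sub>R e \<in> A" using elim BA BD(9) by blast
    moreover have "k * norm e \<le> k * (\<bar>K\<bar> + 1)"
      using elim k by (intro mult_left_mono) auto
    then have "norm (k *\<^sub>R e) \<le> 1" using k by (simp add: k_def)
    ultimately show ?case by simp
  qed
  have "weakly_compact_operator A (\<lambda>b. T o\<^sub>L b)"
    using assms(4) TA by (simp add: weakly_compact_algebra_def A_def)
  then obtain S where S: "S \<in> A"
      "\<And>\<psi> l. \<psi> \<in> dual_of A \<Longrightarrow> ((\<lambda>e. \<psi> (?g e)) \<longlongrightarrow> l) F \<Longrightarrow> \<psi> S = l"
    using weak_cluster_point[OF _ F _ ev_g] AD(6)[OF TA] by blast
  \<comment> \<open>the cluster point is \<open>k T\<close>, since both act alike on every spectral idempotent\<close>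
  have "S - k *\<^sub>R T \<in> jacobson_radical A"
    unfolding A_def
  proof (rule annihilator_in_radical[OF T no_limit ss])
    show "S - k *\<^sub>R T \<in> closed_algebra {T}"
      using S(1) TA AD(8,9) by (simp add: A_def)
    fix p assume "p \<in> ?E"
    then have p: "p \<in> B" using EB by blast
    have "S o\<^sub>L p = k *\<^sub>R T o\<^sub>L p"
    proof (rule eq_if_coef_eq)
      fix x y
      have "((\<lambda>e. coef x y ((k *\<^sub>R T) o\<^sub>L (e o\<^sub>L p))) \<longlongrightarrow> coef x y ((k *\<^sub>R T) o\<^sub>L p)) F"
        by (intro bounded_linear.tendsto[OF bounded_linear_coef]
            bounded_bilinear.tendsto[OF bounded_bilinear_blinfun_compose] tendsto_const approx p)
      moreover have "(k *\<^sub>R T) o\<^sub>L (e o\<^sub>L p) = ?g e o\<^sub>L p" for e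
        by (rule blinfun_eqI) (simp add: blinfun.bilinear_simps)
      ultimately show "coef x y (S o\<^sub>L p) = coef x y (k *\<^sub>R T o\<^sub>L p)"
        by (intro S(2) coef_compose_in_dual) simp
    qed
    then show "(S - k *\<^sub>R T) o\<^sub>L p = 0" by (simp add: compose_simps)
  qed
  then have S_eq: "S = k *\<^sub>R T" using ss by (simp add: semisimple_def A_def)
  have "T \<in> B"
  proof (rule ccontr)
    assume "T \<notin> B"
    then obtain f where f: "bounded_linear f" "\<And>b. b \<in> B \<Longrightarrow> f b = (0::real)" "f T \<noteq> 0"
      using separating_functional[OF BD(2) closed_subalgebra_subspace[OF B_closed]] by metis
    let ?\<phi> = "\<lambda>a. complex_of_real (f a) - \<i> * of_real (f (scale_op \<i> a))"
    \<comment> \<open>a functional that vanishes on \<open>B\<close> vanishes along the filter, hence at the cluster point\<close>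
    have "\<forall>\<^sub>F e in F. ?\<phi> (?g e) = 0"
      using ev
    proof eventually_elim
      case (elim e)
      then have "?g e \<in> B" by (intro TB BD(9)) simp
      then show ?case by (simp add: f(2) BD(5))
    qed
    then have "((\<lambda>e. ?\<phi> (?g e)) \<longlongrightarrow> 0) F" by (rule tendsto_eventually)
    then have "?\<phi> S = 0" by (rule S(2)[OF complexified_functional_in_dual[OF f(1)]])
    then have "Re (?\<phi> S) = 0" by (simp only: zero_complex.sel)
    then have "f S = 0" by simp
    then show False
      using f(3) k by (simp add: S_eq linear_simps[OF f(1)])
  qed
  then have "A \<subseteq> B"
    unfolding A_def by (intro algebra_least[OF T B_closed]) simp
  then show ?thesis using BA by (simp add: A_def B_def)
qed

end
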